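(* Let $R\le\mathbb{C}$ be a subring whose frieze subring $R^\circ$ is contained in $\overline{\mathbb{Q}}$. Then for every positive integer $n$ there are only finitely many non-zero frieze patterns of height $n$ over $R$ if and only if either (i) $R^\circ=\mathbb{Z}$, or (ii) $R^\circ$ is an order in $\mathbb{Q}(\sqrt{d})$ for some $d\in\{-1,-2,-3,-7,-11\}$.
   Context: Let $R$ be a subset of a field. A non-zero frieze pattern of height $n\ge0$ over $R$ is a family $(c_{i,j})$, indexed by $i\in\mathbb{Z}$ and $i\le j\le n+i+3$, with $c_{i,i}=c_{i,n+i+3}=0$, $c_{i,i+1}=c_{i,n+i+2}=1$, $c_{i,j}\in R\setminus\{0\}$ for $i+2\le j\le n+i+1$, and $c_{i,j}c_{i+1,j+1}-c_{i,j+1}c_{i+1,j}=1$ for all $i\in\mathbb{Z}$ and $i+1\le j\le n+i+2$. For a subring $R\le\mathbb{C}$, the frieze subring $R^\circ$ is the subring of $R$ generated by all entries of all non-zero frieze patterns (of all heights) over $R$. $\overline{\mathbb{Q}}\subseteq\mathbb{C}$ is the field of algebraic numbers. An order in a quadratic field $K$ is a subring of $K$ of finite index in the ring of integers $\mathcal{O}_K$. *)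

theory Defs
  imports
    Complex_Main
    "HOL-Library.FuncSet"
    "HOL-Computational_Algebra.Polynomial"
    "HOL-Algebra.Algebraic_Closure_Type"
    "HOL-Algebra.Generated_Fields"
begin

definition frieze_indices :: "nat \<Rightarrow> (int \<times> int) set" where
  "frieze_indices n = {(i, j). i \<le> j \<and> j \<le> int n + i + 3}"

text \<open>
  A family indexed by \<^term>\<open>frieze_indices n\<close> is a function on all of \<^typ>\<open>int \<times> int\<close> that is
  \<^const>\<open>extensional\<close> on the index set. Two such functions are equal iff the families are equal, so
  that patterns are counted correctly.
\<close>

definition nonzero_friezes :: "nat \<Rightarrow> 'a::field set \<Rightarrow> (int \<times> int \<Rightarrow> 'a) set" where
  "nonzero_friezes n R =
     {c \<in> extensional (frieze_indices n).
        (\<forall>i. c (i, i) = 0 \<and> c (i, int n + i + 3) = 0) \<and>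
        (\<forall>i. c (i, i + 1) = 1 \<and> c (i, int n + i + 2) = 1) \<and>
        (\<forall>i j. i + 2 \<le> j \<and> j \<le> int n + i + 1 \<longrightarrow> c (i, j) \<in> R - {0}) \<and>
        (\<forall>i j. i + 1 \<le> j \<and> j \<le> int n + i + 2 \<longrightarrow>
           c (i, j) * c (i + 1, j + 1) - c (i, j + 1) * c (i + 1, j) = 1)}"

abbreviation complex_ring :: "complex ring" where
  "complex_ring \<equiv> ring_of_type_algebra"

text \<open>
  For a subring \<open>R\<close> of the complex numbers, generating inside \<open>R\<close> and generating inside
  \<^const>\<open>complex_ring\<close> yield the same subring.
\<close>

definition frieze_subring :: "complex set \<Rightarrow> complex set" where
  "frieze_subring R = generate_ring complex_ring (\<Union>n. \<Union>c\<in>nonzero_friezes n R. c ` frieze_indices n)"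

text \<open>As \<^term>\<open>csqrt (of_int d)\<close> and its negative generate the same field, the choice of square
  root is irrelevant.\<close>

definition quadratic_field :: "int \<Rightarrow> complex set" where
  "quadratic_field d = generate_field complex_ring {csqrt (of_int d)}"

definition ring_of_integers :: "complex set \<Rightarrow> complex set" where
  "ring_of_integers K = {x \<in> K. algebraic_int x}"

text \<open>The index of \<open>A\<close> in the ring of integers is the one of additive groups, i.e. the number of
  additive cosets of \<open>A\<close>.\<close>

definition is_order_in :: "complex set \<Rightarrow> complex set \<Rightarrow> bool" where
  "is_order_in A K \<longleftrightarrow>
     subring A complex_ring \<and> A \<subseteq> ring_of_integers K \<and>
     finite (a_rcosets\<^bsub>complex_ring\<lparr>carrier := ring_of_integers K\<rparr>\<^esub> A)"

end

theory Submission
  imports Defs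
begin

text \<open>
  The entries of a frieze are the determinants \<open>det2 v\<^sub>i v\<^sub>j\<close> of vectors in the plane, and a polygon whose
  edges are bounded and whose diagonals have absolute value at least 1 has a short ear: otherwise the
  determinants with a fixed vertex would grow along the polygon. Cutting off ears bounds all entries of a
  frieze over a discrete ring. If moreover the elements of absolute value less than 2 are integers, all
  ears are \<open>\<plusminus>1\<close> and all entries are integers.

  Conversely, a unit \<open>u\<close> gives the frieze of height 1 with entries \<open>u\<close> and \<open>2/u\<close>, so finiteness forces the
  ring to have finitely many units. By pigeonhole arguments in the style of Dirichlet, a ring of algebraic
  numbers with finitely many units contains no element of degree at least 3, no real quadratic
  irrationality and no non-integral element. The remaining rings are \<open>\<int>\<close> and imaginary quadratic orders.
  If such an order is generated by frieze entries, it contains a non-integer \<open>w\<close> with \<open>|w| < 2\<close>, and the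
  discriminant of \<open>w\<close> determines the field.
\<close>

section \<open>Polygons with short ears\<close>

text \<open>Write |xy| for the norm of \<open>det2 x y\<close>. The threshold
  \<open>L * (L + 1)\<close> for a short ear makes the growth sustain itself: from |uw| >= L (L +
  1), |uv| <= L, |vw| <= L and |pu| <= |pv| follows L |pw| >= L (L + 1) |pv| - L |pu| >= L^2 |pv|.
  At L = 1, the edge length of a frieze polygon, the threshold is 2; this is the origin of the bound
  2 for short elements. It also decides which fields occur: a non-integer w with |w| < 2 has norm at
  most 3, which leaves the discriminants -3, -4, -7, -8, -11 and -12.

  The unit arguments see a single embedding, the given one into the complex numbers; the size of
  integer coordinates stands in for the other embeddings and for the field norm. Infinitely many
  units arise as soon as the rank of the ring exceeds the real dimension of the region of values,
  that is, outside the rationals and the imaginary quadratic fields. A non-integral imaginary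
  quadratic y needs a different argument: the additive group of Z[y] is not finitely generated, so
  elements have no coordinates of fixed length.\<close>

definition det2 :: "'a::comm_ring \<times> 'a \<Rightarrow> 'a \<times> 'a \<Rightarrow> 'a" where
  "det2 u v = fst u * snd v - snd u * fst v"

lemma det2_self [simp]: "det2 u u = 0"
  by (simp add: det2_def mult.commute)

lemma det2_commute: "det2 v u = - det2 u v"
  by (simp add: det2_def algebra_simps)

lemma norm_det2_commute: "norm (det2 v u) = norm (det2 u v :: 'a::{real_normed_field})"
  by (metis det2_commute norm_minus_cancel)

lemma det2_three_term: "det2 a c * det2 b v = det2 b c * det2 a v + det2 a b * det2 c v"
  by (simp add: det2_def algebra_simps)

text \<open>
  If no ear is short, then \<open>|det2 p x|\<close> grows along the list, so the closing edge of the polygon cannot be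
  short.
\<close>

lemma norm_det2_increasing:
  fixes p u v :: "'a::real_normed_field \<times> 'a"
  assumes L: "L \<ge> 1"
    and "successively (\<lambda>x y. norm (det2 x y) \<le> L) (u # v # ws)"
    and "\<And>xs a b c ys. u # v # ws = xs @ a # b # c # ys \<Longrightarrow> norm (det2 a c) \<ge> L * (L + 1)"
    and "norm (det2 p u) \<le> norm (det2 p v)"
  shows "norm (det2 p v) \<le> norm (det2 p (last (v # ws)))"
  using assms(2-)
proof (induction ws arbitrary: u v)
  case Nil
  then show ?case by simp
next
  case (Cons w ws)
  have uw: "norm (det2 u w) \<ge> L * (L + 1)"
    using Cons.prems(2)[of "[]" u v w ws] by simp
  have uv: "norm (det2 u v) \<le> L" and vw: "norm (det2 v w) \<le> L"
    using Cons.prems(1) by auto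
  have eq: "det2 u v * det2 p w = det2 u w * det2 p v - det2 v w * det2 p u"
    by (simp add: det2_def algebra_simps)
  have "L * (L + 1) * norm (det2 p v) \<le> norm (det2 u w) * norm (det2 p v)"
    using uw by (intro mult_right_mono) auto
  also have "\<dots> \<le> norm (det2 u v * det2 p w) + norm (det2 v w * det2 p u)"
    unfolding eq norm_mult[symmetric] by (metis add.commute norm_triangle_sub)
  also have "\<dots> \<le> L * norm (det2 p w) + L * norm (det2 p v)"
    unfolding norm_mult using uv vw Cons.prems(3) L
    by (intro add_mono mult_mono) auto
  finally have "L * (L * norm (det2 p v)) \<le> L * norm (det2 p w)"
    by (simp add: algebra_simps)
  then have "L * norm (det2 p v) \<le> norm (det2 p w)"
    using L by simp
  moreover have "norm (det2 p v) \<le> L * norm (det2 p v)"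
    using L by (simp add: mult_le_cancel_right1)
  ultimately have le: "norm (det2 p v) \<le> norm (det2 p w)" by linarith
  have "norm (det2 p w) \<le> norm (det2 p (last (w # ws)))"
  proof (rule Cons.IH)
    show "successively (\<lambda>x y. norm (det2 x y) \<le> L) (v # w # ws)"
      using Cons.prems(1) by simp
    show "norm (det2 a c) \<ge> L * (L + 1)" if "v # w # ws = xs @ a # b # c # ys" for xs a b c ys
      using Cons.prems(2)[of "u # xs" a b c ys] that by simp
  qed (fact le)
  with le show ?case by simp
qed

text \<open>Seen from the first vertex p, a long first ear gives |pv| >= L (L + 1) >= L + 1 > |pu|,
  which starts the growth, and growth up to the last vertex contradicts the closing edge. Ears are
  sought strictly inside the list, so that \<open>hd\<close> and \<open>last\<close>, and with them
  the closing edge, survive the removal.\<close>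

lemma ex_short_ear:
  fixes ps :: "('a::real_normed_field \<times> 'a) list"
  assumes L: "L \<ge> 1" and len: "length ps \<ge> 3"
    and sorted: "sorted_wrt (\<lambda>x y. norm (det2 x y) \<ge> 1) ps"
    and succ: "successively (\<lambda>x y. norm (det2 x y) \<le> L) ps"
    and close: "norm (det2 (hd ps) (last ps)) \<le> L"
  obtains xs a b c ys where "ps = xs @ a # b # c # ys" "norm (det2 a c) < L * (L + 1)"
proof (rule ccontr)
  note that_ear = that
  assume "\<not> thesis"
  then have no: "norm (det2 a c) \<ge> L * (L + 1)" if "ps = xs @ a # b # c # ys" for xs a b c ys
    using that_ear[OF that] \<open>\<not> thesis\<close> by (meson not_le)
  obtain p u v ws where ps: "ps = p # u # v # ws"
    using len by (metis (no_types, lifting) One_nat_def Suc_1 Suc_le_length_iff numeral_3_eq_3)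
  have pv: "norm (det2 p v) \<ge> L * (L + 1)"
    using no[of "[]" p u v ws] ps by simp
  have pu: "norm (det2 p u) \<le> L" using succ ps by simp
  have Lp: "L + 1 \<le> L * (L + 1)" using L by (simp add: mult_le_cancel_right1)
  have "norm (det2 p v) \<le> norm (det2 p (last (v # ws)))"
  proof (rule norm_det2_increasing[OF L])
    show "successively (\<lambda>x y. norm (det2 x y) \<le> L) (u # v # ws)"
      using succ ps by simp
    show "norm (det2 a c) \<ge> L * (L + 1)" if "u # v # ws = xs @ a # b # c # ys" for xs a b c ys
      using no[of "p # xs" a b c ys] that ps by simp
    show "norm (det2 p u) \<le> norm (det2 p v)"
      using pu pv Lp by linarith
  qed
  with close ps have "norm (det2 p v) \<le> L" by simp
  with pv Lp show False by linarith
qed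

lemma remove_ear:
  assumes ps: "ps = xs @ a # b # c # ys" and qs: "qs = xs @ a # c # ys"
  shows "hd qs = hd ps" "last qs = last ps" "set ps = insert b (set qs)" "length ps = Suc (length qs)"
    "sorted_wrt P ps \<Longrightarrow> sorted_wrt P qs"
    "successively Q ps \<Longrightarrow> Q a c \<Longrightarrow> successively Q qs"
    "successively Q ps \<Longrightarrow> Q a b" "successively Q ps \<Longrightarrow> Q b c"
    "sorted_wrt P ps \<Longrightarrow> P a c"
  unfolding ps qs by (auto simp: hd_append sorted_wrt_append successively_append_iff successively_Cons)

text \<open>Cutting off the ear at b creates an edge ac of length up to L (L + 1), so L has to vary
  in the induction on the number of vertices. Since |ac| >= 1, the three-term relation bounds every
  diagonal at b by 2 L B, where B is the bound for the smaller polygon with the larger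
  edges.\<close>

lemma polygon_bounded:
  assumes "L \<ge> 1"
  shows "\<exists>B\<ge>L. \<forall>ps :: ('a::real_normed_field \<times> 'a) list.
           length ps \<le> n \<longrightarrow> sorted_wrt (\<lambda>x y. norm (det2 x y) \<ge> 1) ps \<longrightarrow>
           successively (\<lambda>x y. norm (det2 x y) \<le> L) ps \<longrightarrow> norm (det2 (hd ps) (last ps)) \<le> L \<longrightarrow>
           (\<forall>u\<in>set ps. \<forall>v\<in>set ps. norm (det2 u v) \<le> B)"
  using assms
proof (induction n arbitrary: L)
  case 0
  then show ?case by (intro exI[of _ L]) auto
next
  case (Suc n)
  let ?L' = "L * (L + 1)"
  have L': "L \<le> ?L'" "1 \<le> ?L'"
    using Suc.prems by (auto simp: mult_le_cancel_left1 intro: order_trans)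
  obtain B where B: "B \<ge> ?L'" and IH: "\<And>ps :: ('a \<times> 'a) list. \<lbrakk>length ps \<le> n;
      sorted_wrt (\<lambda>x y. norm (det2 x y) \<ge> 1) ps; successively (\<lambda>x y. norm (det2 x y) \<le> ?L') ps;
      norm (det2 (hd ps) (last ps)) \<le> ?L'\<rbrakk> \<Longrightarrow> \<forall>u\<in>set ps. \<forall>v\<in>set ps. norm (det2 u v) \<le> B"
    using Suc.IH[OF L'(2)] by metis
  have B1: "B \<ge> 1" "B \<ge> L" using B L' by linarith+
  then have LB: "B \<le> 2 * L * B" "L \<le> 2 * L * B"
    using Suc.prems by (auto simp: mult_le_cancel_right1 mult_le_cancel_left1 intro: order_trans)
  show ?case
  proof (intro exI[of _ "2 * L * B"] conjI allI impI)
    fix ps :: "('a \<times> 'a) list"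
    assume ps: "length ps \<le> Suc n" "sorted_wrt (\<lambda>x y. norm (det2 x y) \<ge> 1) ps"
      "successively (\<lambda>x y. norm (det2 x y) \<le> L) ps" "norm (det2 (hd ps) (last ps)) \<le> L"
    show "\<forall>u\<in>set ps. \<forall>v\<in>set ps. norm (det2 u v) \<le> 2 * L * B"
    proof (cases "length ps \<ge> 3")
      case False
      then consider "ps = []" | u where "ps = [u]" | u v where "ps = [u, v]"
        by (auto simp: not_le numeral_3_eq_3 less_Suc_eq length_Suc_conv)
      then show ?thesis
      proof cases
        case 3
        with ps(4) have "norm (det2 u v) \<le> L" "norm (det2 v u) \<le> L"
          by (simp_all add: norm_det2_commute)
        then have "norm (det2 u v) \<le> 2 * L * B" "norm (det2 v u) \<le> 2 * L * B"
          using LB(2) by linarith+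
        with 3 LB Suc.prems B1 show ?thesis by simp
      qed (use LB Suc.prems in auto)
    next
      case True
      obtain xs a b c ys where ear: "ps = xs @ a # b # c # ys" "norm (det2 a c) < ?L'"
        using ex_short_ear[OF Suc.prems True ps(2-4)] .
      define qs where "qs = xs @ a # c # ys"
      note rem = remove_ear[OF ear(1) qs_def]
      have "successively (\<lambda>x y. norm (det2 x y) \<le> ?L') ps"
        using ps(3) by (rule successively_mono) (use L'(1) in auto)
      then have "successively (\<lambda>x y. norm (det2 x y) \<le> ?L') qs"
        using ear(2) rem(6)[of "\<lambda>x y. norm (det2 x y) \<le> ?L'"] by simp
      then have qs: "\<forall>u\<in>set qs. \<forall>v\<in>set qs. norm (det2 u v) \<le> B"
        using ps(1,4) rem(1,2,4) rem(5)[OF ps(2)] L'(1) by (intro IH) auto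
      have bv: "norm (det2 b v) \<le> 2 * L * B" if "v \<in> set qs" for v
      proof -
        have "1 * norm (det2 b v) \<le> norm (det2 a c) * norm (det2 b v)"
          using rem(9)[OF ps(2)] by (intro mult_right_mono) auto
        also have "\<dots> = norm (det2 b c * det2 a v + det2 a b * det2 c v)"
          by (simp only: norm_mult[symmetric] det2_three_term[of a c b v])
        also have "\<dots> \<le> norm (det2 b c) * norm (det2 a v) + norm (det2 a b) * norm (det2 c v)"
          by (metis norm_mult norm_triangle_ineq)
        also have "\<dots> \<le> L * B + L * B"
          using that qs rem(7)[OF ps(3)] rem(8)[OF ps(3)] Suc.prems
          by (intro add_mono mult_mono) (auto simp: qs_def)
        finally show ?thesis by (simp add: algebra_simps)
      qed
      show ?thesis
      proof (intro ballI)
        fix u v assume "u \<in> set ps" "v \<in> set ps"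
        then consider "u \<in> set qs" "v \<in> set qs" | "u = b" "v \<in> set qs" | "u \<in> set qs" "v = b"
          | "u = b" "v = b"
          using rem(3) by auto
        then show "norm (det2 u v) \<le> 2 * L * B"
        proof cases
          case 1
          with qs LB show ?thesis by fastforce
        next
          case 2
          with bv show ?thesis by simp
        next
          case 3
          with bv show ?thesis by (simp add: norm_det2_commute[of u])
        next
          case 4
          with LB B1 show ?thesis by simp
        qed
      qed
    qed
  qed (use LB in simp)
qed

lemma Ints_norm_less_2:
  fixes x :: complex
  assumes "x \<in> \<int>" "norm x < 2"
  shows "x \<in> {-1, 0, 1}"
proof -
  obtain k where "x = of_int k" using assms(1) by (auto elim: Ints_cases)
  with assms(2) have "\<bar>k\<bar> < 2" by (simp flip: of_int_abs)
  then have "k = -1 \<or> k = 0 \<or> k = 1" by arith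
  with \<open>x = of_int k\<close> show ?thesis by auto
qed

text \<open>Here the cut-off diagonal has absolute value at least 1 and less than 2, so by
  \<open>short\<close> it is -1 or 1. Hence the edges do not deteriorate as in
  \<open>polygon_bounded\<close>, and dividing by \<open>det2 a c\<close> in the three-term relation
  stays within the integers.\<close>

lemma polygon_Ints:
  fixes ps :: "(complex \<times> complex) list"
  assumes short: "\<And>w. w \<in> S \<Longrightarrow> norm w < 2 \<Longrightarrow> w \<in> \<int>"
    and "sorted_wrt (\<lambda>x y. det2 x y \<in> S \<and> norm (det2 x y) \<ge> 1) ps"
    and "successively (\<lambda>x y. det2 x y \<in> {-1, 1}) ps"
    and "det2 (hd ps) (last ps) \<in> {-1, 0, 1}"
  shows "\<forall>u\<in>set ps. \<forall>v\<in>set ps. det2 u v \<in> \<int>"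
  using assms(2-)
proof (induction "length ps" arbitrary: ps rule: less_induct)
  case less
  show ?case
  proof (cases "length ps \<ge> 3")
    case False
    then consider "ps = []" | u where "ps = [u]" | u v where "ps = [u, v]"
      by (auto simp: not_le numeral_3_eq_3 less_Suc_eq length_Suc_conv)
    then show ?thesis
    proof cases
      case 3
      with less.prems(3) have "det2 u v \<in> \<int>" by auto
      then have "det2 v u \<in> \<int>" by (simp add: det2_commute[of v u] minus_in_Ints_iff)
      with 3 \<open>det2 u v \<in> \<int>\<close> show ?thesis by simp
    qed auto
  next
    case True
    have sorted: "sorted_wrt (\<lambda>x y. norm (det2 x y) \<ge> 1) ps"
      using less.prems(1) by (rule sorted_wrt_mono_rel[rotated]) auto
    have succ: "successively (\<lambda>x y. norm (det2 x y) \<le> 1) ps"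
      using less.prems(2) by (rule successively_mono) auto
    have "norm (det2 (hd ps) (last ps)) \<le> 1" using less.prems(3) by auto
    then obtain xs a b c ys where ear: "ps = xs @ a # b # c # ys" "norm (det2 a c) < 1 * (1 + 1)"
      by (rule ex_short_ear[OF order_refl True sorted succ])
    define qs where "qs = xs @ a # c # ys"
    note rem = remove_ear[OF ear(1) qs_def]
    have ac: "det2 a c \<in> S" "norm (det2 a c) \<ge> 1" using rem(9)[OF less.prems(1)] by auto
    then have "det2 a c \<in> {-1, 0, 1}" using short ear(2) by (intro Ints_norm_less_2) auto
    with ac have ac1: "det2 a c \<in> {-1, 1}" by auto
    have qs: "\<forall>u\<in>set qs. \<forall>v\<in>set qs. det2 u v \<in> \<int>"
    proof (rule less.hyps)
      show "successively (\<lambda>x y. det2 x y \<in> {-1, 1}) qs"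
        using rem(6)[OF less.prems(2)] ac1 by blast
      show "det2 (hd qs) (last qs) \<in> {-1, 0, 1}"
        unfolding rem(1,2) by (fact less.prems(3))
    qed (use rem(4) rem(5)[OF less.prems(1)] in simp_all)
    have bv: "det2 b v \<in> \<int>" if "v \<in> set qs" for v
    proof -
      have e: "det2 a b \<in> \<int>" "det2 b c \<in> \<int>"
        using rem(7)[OF less.prems(2)] rem(8)[OF less.prems(2)] by auto
      have "det2 b c * det2 a v + det2 a b * det2 c v \<in> \<int>"
        using that qs e by (auto intro!: Ints_add Ints_mult simp: qs_def)
      then have "det2 a c * det2 b v \<in> \<int>" by (simp only: det2_three_term[of a c b v])
      with ac1 have "- det2 b v \<in> \<int> \<or> det2 b v \<in> \<int>" by auto
      then show ?thesis by (auto simp: minus_in_Ints_iff)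
    qed
    have "det2 v b \<in> \<int>" if "v \<in> set qs" for v
      using bv[OF that] by (simp add: det2_commute[of v b] minus_in_Ints_iff)
    with qs bv show ?thesis unfolding rem(3) by auto
  qed
qed

section \<open>Friezes as determinants\<close>

lemma successively_upto: "successively (\<lambda>i j. j = i + 1) [a..b::int]"
proof (induction a b rule: upto.induct)
  case (1 i j)
  show ?case
  proof (cases "i + 1 \<le> j")
    case True
    then have "[i..j] = i # (i + 1) # [i + 1 + 1..j]" "[i + 1..j] = (i + 1) # [i + 1 + 1..j]"
      by (simp_all add: upto_rec1)
    with 1 True show ?thesis by simp
  next
    case False
    then have "[i..j] = [] \<or> [i..j] = [i]" by (cases "i = j") auto
    then show ?thesis by auto
  qed
qed

lemma frieze_zero:
  assumes "c \<in> nonzero_friezes n R"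
  shows "c (i, i) = 0" "c (i, int n + i + 3) = 0"
  using assms by (auto simp: nonzero_friezes_def)

lemma frieze_one:
  assumes "c \<in> nonzero_friezes n R"
  shows "c (i, i + 1) = 1" "c (i, int n + i + 2) = 1"
  using assms by (auto simp: nonzero_friezes_def)

lemma frieze_rule:
  assumes "c \<in> nonzero_friezes n R" "i + 1 \<le> j" "j \<le> int n + i + 2"
  shows "c (i, j) * c (i + 1, j + 1) - c (i, j + 1) * c (i + 1, j) = 1"
  using assms by (auto simp: nonzero_friezes_def)

text \<open>The range includes the two border diagonals of ones; as \<open>R\<close> is an arbitrary
  set, 1 has to be inserted.\<close>

lemma frieze_interior:
  assumes "c \<in> nonzero_friezes n R" "i < j" "j \<le> int n + i + 2"
  shows "c (i, j) \<noteq> 0" "c (i, j) \<in> insert 1 R"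
proof -
  consider "j = i + 1" | "j = int n + i + 2" | "i + 2 \<le> j" "j \<le> int n + i + 1"
    using assms by linarith
  then have "c (i, j) \<noteq> 0 \<and> c (i, j) \<in> insert 1 R"
    by cases (use assms(1) in \<open>auto simp: nonzero_friezes_def\<close>)
  then show "c (i, j) \<noteq> 0" "c (i, j) \<in> insert 1 R" by auto
qed

text \<open>Two adjacent rows, read columnwise, are the coordinates of a polygon; by the frieze rule
  consecutive vertices have determinant 1.\<close>

definition frieze_vec :: "(int \<times> int \<Rightarrow> 'a) \<Rightarrow> int \<Rightarrow> int \<Rightarrow> 'a \<times> 'a" where
  "frieze_vec c k j = (c (k, j), c (k + 1, j))"

text \<open>Both sides obey the frieze rule, the determinants by a Pluecker relation. The rule
  determines an entry from its three neighbours if the opposite one is non-zero, so the two sides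
  agree row by row and, within a row, from left to right.\<close>

lemma frieze_eq_det2:
  assumes c: "c \<in> nonzero_friezes n R"
    and ij: "k + 1 \<le> i" "i \<le> j" "j \<le> k + int n + 3"
  shows "c (i, j) = det2 (frieze_vec c k i) (frieze_vec c k j)"
proof -
  define E where "E i j = det2 (frieze_vec c k i) (frieze_vec c k j)" for i j
  have pluecker: "E i j * E (i + 1) (j + 1) - E i (j + 1) * E (i + 1) j = E i (i + 1) * E j (j + 1)" for i j
    by (simp add: E_def det2_def algebra_simps)
  have E1: "E j (j + 1) = 1" if "k + 1 \<le> j" "j \<le> k + int n + 2" for j
    using frieze_rule[OF c, of k j] that by (simp add: E_def det2_def frieze_vec_def algebra_simps)
  have "\<forall>j. i \<le> j \<and> j \<le> k + int n + 3 \<longrightarrow> c (i, j) = E i j"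
    using ij(1)
  proof (induction i rule: int_ge_induct)
    case base
    show ?case
      using frieze_zero(1)[OF c, of "k + 1"] frieze_one(1)[OF c, of k]
      by (simp add: E_def det2_def frieze_vec_def)
  next
    case (step i)
    have "c (i + 1, j) = E (i + 1) j" if "i + 1 \<le> j" "j \<le> k + int n + 3" for j
      using that
    proof (induction j rule: int_ge_induct)
      case base
      then show ?case using frieze_zero(1)[OF c, of "i + 1"] by (simp add: E_def)
    next
      case (step j)
      have "c (i, j) * c (i + 1, j + 1) - c (i, j + 1) * c (i + 1, j) = 1"
        using step by (intro frieze_rule[OF c]) (use \<open>k + 1 \<le> i\<close> in linarith)+
      moreover have "E i j * E (i + 1) (j + 1) - E i (j + 1) * E (i + 1) j = 1"
        unfolding pluecker using step \<open>k + 1 \<le> i\<close> by (subst (1 2) E1) auto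
      moreover have "c (i, j) = E i j" "c (i, j + 1) = E i (j + 1)" "c (i + 1, j) = E (i + 1) j"
        using step \<open>\<forall>j. i \<le> j \<and> j \<le> k + int n + 3 \<longrightarrow> c (i, j) = E i j\<close> by auto
      ultimately have "E i j * (c (i + 1, j + 1) - E (i + 1) (j + 1)) = 0"
        by (simp add: algebra_simps)
      moreover have "E i j \<noteq> 0"
        unfolding \<open>c (i, j) = E i j\<close>[symmetric]
        using step \<open>k + 1 \<le> i\<close> by (intro frieze_interior(1)[OF c]) auto
      ultimately show ?case by simp
    qed
    then show ?case by auto
  qed
  with ij show ?thesis by (simp add: E_def)
qed

text \<open>These are exactly the n + 3 columns in which rows k and k + 1 are both defined.\<close>

definition frieze_vecs :: "nat \<Rightarrow> (int \<times> int \<Rightarrow> 'a) \<Rightarrow> int \<Rightarrow> ('a \<times> 'a) list" where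
  "frieze_vecs n c k = map (frieze_vec c k) [k + 1..k + int n + 3]"

lemma frieze_vecs:
  assumes c: "c \<in> nonzero_friezes n R"
  shows "length (frieze_vecs n c k) = n + 3"
    and "sorted_wrt (\<lambda>x y. det2 x y \<in> insert 1 R \<and> det2 x y \<noteq> 0) (frieze_vecs n c k)"
    and "successively (\<lambda>x y. det2 x y = 1) (frieze_vecs n c k)"
    and "det2 (hd (frieze_vecs n c k)) (last (frieze_vecs n c k)) = 1"
proof -
  note eq = frieze_eq_det2[OF c, of k, symmetric]
  show "length (frieze_vecs n c k) = n + 3"
    by (simp add: frieze_vecs_def)
  have "sorted_wrt (\<lambda>i j. det2 (frieze_vec c k i) (frieze_vec c k j) \<in> insert 1 R \<and>
      det2 (frieze_vec c k i) (frieze_vec c k j) \<noteq> 0) [k + 1..k + int n + 3]"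
  proof (rule sorted_wrt_mono_rel[OF _ sorted_wrt_upto])
    fix i j assume "i \<in> set [k + 1..k + int n + 3]" "j \<in> set [k + 1..k + int n + 3]" "i < j"
    then show "det2 (frieze_vec c k i) (frieze_vec c k j) \<in> insert 1 R \<and>
        det2 (frieze_vec c k i) (frieze_vec c k j) \<noteq> 0"
      using frieze_interior[OF c, of i j] by (simp add: eq)
  qed
  then show "sorted_wrt (\<lambda>x y. det2 x y \<in> insert 1 R \<and> det2 x y \<noteq> 0) (frieze_vecs n c k)"
    by (simp add: frieze_vecs_def sorted_wrt_map)
  have "successively (\<lambda>i j. det2 (frieze_vec c k i) (frieze_vec c k j) = 1) [k + 1..k + int n + 3]"
  proof (rule successively_mono[OF successively_upto])
    fix i j assume "i \<in> set [k + 1..k + int n + 3]" "j \<in> set [k + 1..k + int n + 3]" "j = i + 1"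
    then show "det2 (frieze_vec c k i) (frieze_vec c k j) = 1"
      using frieze_one(1)[OF c, of i] by (simp add: eq)
  qed
  then show "successively (\<lambda>x y. det2 x y = 1) (frieze_vecs n c k)"
    by (simp add: frieze_vecs_def successively_map)
  have "[k + 1..k + int n + 3] = (k + 1) # [k + 1 + 1..k + int n + 3]"
    "[k + 1..k + int n + 3] = [k + 1..k + int n + 3 - 1] @ [k + int n + 3]"
    by (intro upto_rec1 upto_rec2; simp)+
  then have "hd [k + 1..k + int n + 3] = k + 1" "last [k + 1..k + int n + 3] = k + int n + 3"
    by (metis list.sel(1), metis last_snoc)
  then have "det2 (hd (frieze_vecs n c k)) (last (frieze_vecs n c k)) = c (k + 1, k + int n + 3)"
    by (simp add: frieze_vecs_def hd_map last_map eq)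
  also have "\<dots> = 1"
    using frieze_one(2)[OF c, of "k + 1"] by (simp add: algebra_simps)
  finally show "det2 (hd (frieze_vecs n c k)) (last (frieze_vecs n c k)) = 1" .
qed

text \<open>Row i is read off from the polygon of rows i - 1 and i. Its last index n + i + 3 lies
  outside the columns of that polygon, but the entry there is 0.\<close>

lemma frieze_entry_cases:
  assumes c: "c \<in> nonzero_friezes n R" and ij: "i \<le> j" "j \<le> int n + i + 3"
  obtains "c (i, j) = 0"
  | u v where "u \<in> set (frieze_vecs n c (i - 1))" "v \<in> set (frieze_vecs n c (i - 1))" "c (i, j) = det2 u v"
proof (cases "j = int n + i + 3")
  case True
  with frieze_zero(2)[OF c, of i] that(1) show ?thesis by simp
next
  case False
  with ij show ?thesis
    by (intro that(2)[of "frieze_vec c (i - 1) i" "frieze_vec c (i - 1) j"])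
       (simp_all add: frieze_vecs_def frieze_eq_det2[OF c, of "i - 1" i j])
qed

text \<open>The rule, divided by a non-zero corner, propagates row 0 in both directions. Row i + 1
  is filled from the zero at its left end, row i - 1 from the zero at its right end.\<close>

lemma frieze_eqI:
  assumes c: "c \<in> nonzero_friezes n R" and c': "c' \<in> nonzero_friezes n R"
    and row: "\<And>j. 0 \<le> j \<Longrightarrow> j \<le> int n + 3 \<Longrightarrow> c (0, j) = c' (0, j)"
  shows "c = c'"
proof -
  have "\<forall>j. i \<le> j \<and> j \<le> int n + i + 3 \<longrightarrow> c (i, j) = c' (i, j)" for i
  proof (induction i rule: int_induct[where k = 0])
    case base
    show ?case using row by auto
  next
    case (step1 i)
    have "c (i + 1, j) = c' (i + 1, j)" if "i + 1 \<le> j" "j \<le> int n + i + 3" for j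
      using that
    proof (induction j rule: int_ge_induct)
      case base
      then show ?case using frieze_zero(1)[OF c, of "i + 1"] frieze_zero(1)[OF c', of "i + 1"] by simp
    next
      case (step j)
      have "c (i, j) * c (i + 1, j + 1) - c (i, j + 1) * c (i + 1, j) = 1"
        and "c' (i, j) * c' (i + 1, j + 1) - c' (i, j + 1) * c' (i + 1, j) = 1"
        using step frieze_rule[OF c, of i j] frieze_rule[OF c', of i j] by auto
      moreover have "c (i, j) = c' (i, j)" "c (i, j + 1) = c' (i, j + 1)" "c (i + 1, j) = c' (i + 1, j)"
        using step step1 by auto
      ultimately have "c' (i, j) * (c (i + 1, j + 1) - c' (i + 1, j + 1)) = 0"
        by (simp add: algebra_simps)
      moreover have "c' (i, j) \<noteq> 0"
        using step by (intro frieze_interior(1)[OF c']) auto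
      ultimately show ?case by simp
    qed
    moreover have "c (i + 1, int n + (i + 1) + 3) = c' (i + 1, int n + (i + 1) + 3)"
      by (simp only: frieze_zero(2)[OF c] frieze_zero(2)[OF c'])
    moreover have "j \<le> int n + i + 3 \<or> j = int n + (i + 1) + 3" if "j \<le> int n + (i + 1) + 3" for j
      using that by linarith
    ultimately show ?case by blast
  next
    case (step2 i)
    have "c (i - 1, j) = c' (i - 1, j)" if "j \<le> int n + i + 2" "i \<le> j" for j
      using that
    proof (induction j rule: int_le_induct)
      case base
      have "int n + i + 2 = int n + (i - 1) + 3" by simp
      then show ?case
        by (simp only: frieze_zero(2)[OF c] frieze_zero(2)[OF c'])
    next
      case (step j)
      have "c (i - 1, j - 1) * c (i, j) - c (i - 1, j) * c (i, j - 1) = 1"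
        and "c' (i - 1, j - 1) * c' (i, j) - c' (i - 1, j) * c' (i, j - 1) = 1"
        using step frieze_rule[OF c, of "i - 1" "j - 1"] frieze_rule[OF c', of "i - 1" "j - 1"] by auto
      moreover have "c (i, j) = c' (i, j)" "c (i - 1, j) = c' (i - 1, j)" "c (i, j - 1) = c' (i, j - 1)"
        using step step2 by auto
      ultimately have "c' (i, j) * (c (i - 1, j - 1) - c' (i - 1, j - 1)) = 0"
        by (simp add: algebra_simps)
      moreover have "c' (i, j) \<noteq> 0"
        using step by (intro frieze_interior(1)[OF c']) auto
      ultimately show ?case by simp
    qed
    moreover have "c (i - 1, i - 1) = c' (i - 1, i - 1)"
      by (simp only: frieze_zero(1)[OF c] frieze_zero(1)[OF c'])
    moreover have "(j \<le> int n + i + 2 \<and> i \<le> j) \<or> j = i - 1"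
      if "i - 1 \<le> j" "j \<le> int n + (i - 1) + 3" for j
      using that by linarith
    ultimately show ?case by blast
  qed
  moreover have "c \<in> extensional (frieze_indices n)" "c' \<in> extensional (frieze_indices n)"
    using c c' by (auto simp: nonzero_friezes_def)
  ultimately show ?thesis
    by (intro extensionalityI[of c "frieze_indices n" c']) (auto simp: frieze_indices_def)
qed

text \<open>By \<open>frieze_eqI\<close> row 0 determines the frieze, and its n + 4 entries lie in a
  finite set by \<open>polygon_bounded\<close> with edges of length 1.\<close>

lemma finite_nonzero_friezes:
  fixes R :: "'a::real_normed_field set"
  assumes ge1: "\<And>x. x \<in> R \<Longrightarrow> x \<noteq> 0 \<Longrightarrow> norm x \<ge> 1"
    and fin: "\<And>B. finite {x \<in> R. norm x \<le> B}"
  shows "finite (nonzero_friezes n R)"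
proof -
  obtain B :: real where B: "B \<ge> 1" and bound: "\<And>ps :: ('a \<times> 'a) list. \<lbrakk>length ps \<le> n + 3;
      sorted_wrt (\<lambda>x y. norm (det2 x y) \<ge> 1) ps; successively (\<lambda>x y. norm (det2 x y) \<le> 1) ps;
      norm (det2 (hd ps) (last ps)) \<le> 1\<rbrakk> \<Longrightarrow> \<forall>u\<in>set ps. \<forall>v\<in>set ps. norm (det2 u v) \<le> B"
    using polygon_bounded[of 1 "n + 3", where 'a = 'a] by auto
  define F where "F = insert 0 (insert 1 {x \<in> R. norm x \<le> B})"
  have F: "c (i, j) \<in> F" if c: "c \<in> nonzero_friezes n R" and ij: "i \<le> j" "j \<le> int n + i + 3" for c i j
    using frieze_entry_cases[OF c ij]
  proof cases
    case 1
    then show ?thesis by (simp add: F_def)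
  next
    case (2 u v)
    note vecs = frieze_vecs[OF c, of "i - 1"]
    have "sorted_wrt (\<lambda>x y. norm (det2 x y) \<ge> 1) (frieze_vecs n c (i - 1))"
      using vecs(2) by (rule sorted_wrt_mono_rel[rotated]) (use ge1 in auto)
    moreover have "successively (\<lambda>x y. norm (det2 x y) \<le> 1) (frieze_vecs n c (i - 1))"
      using vecs(3) by (rule successively_mono) auto
    ultimately have "norm (c (i, j)) \<le> B"
      using bound[of "frieze_vecs n c (i - 1)"] 2 vecs(1,4) by auto
    moreover have "c (i, j) = 0 \<or> c (i, j) \<in> insert 1 R"
      using frieze_interior(2)[OF c, of i j] frieze_zero[OF c, of i] ij
      by (cases "i = j \<or> j = int n + i + 3") auto
    ultimately show ?thesis by (auto simp: F_def)
  qed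
  have "(\<lambda>c. \<lambda>j\<in>{0..int n + 3}. c (0, j)) ` nonzero_friezes n R \<subseteq> {0..int n + 3} \<rightarrow>\<^sub>E F"
    using F[of _ 0] by (auto simp: PiE_iff)
  moreover have "finite ({0..int n + 3} \<rightarrow>\<^sub>E F)"
    using fin by (intro finite_PiE) (auto simp: F_def)
  ultimately have "finite ((\<lambda>c. \<lambda>j\<in>{0..int n + 3}. c (0, j)) ` nonzero_friezes n R)"
    by (rule finite_subset)
  then show ?thesis
  proof (rule finite_imageD)
    show "inj_on (\<lambda>c. \<lambda>j\<in>{0..int n + 3}. c (0, j)) (nonzero_friezes n R)"
    proof (rule inj_onI)
      fix c c' assume c: "c \<in> nonzero_friezes n R" "c' \<in> nonzero_friezes n R"
        and eq: "(\<lambda>j\<in>{0..int n + 3}. c (0, j)) = (\<lambda>j\<in>{0..int n + 3}. c' (0, j))"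
      show "c = c'"
      proof (rule frieze_eqI[OF c])
        fix j assume "0 \<le> j" "j \<le> int n + 3"
        then show "c (0, j) = c' (0, j)"
          using fun_cong[OF eq, of j] by simp
      qed
    qed
  qed
qed

lemma infinite_friezes_of_units:
  fixes R :: "'a::field_char_0 set"
  assumes two: "\<And>x. x \<in> R \<Longrightarrow> 2 * x \<in> R"
    and inf: "infinite {u \<in> R. u \<noteq> 0 \<and> inverse u \<in> R}"
  shows "infinite (nonzero_friezes 1 R)"
proof
  assume fin: "finite (nonzero_friezes 1 R)"
  \<comment> \<open>In height 1 the rule says for interior entries that neighbours have product 2,
    so they alternate between \<open>u\<close> and \<open>2 * inverse u\<close> with the parity of
    \<open>i\<close>.\<close>
  define c where "c u = (\<lambda>p\<in>frieze_indices 1. case p of (i, j) \<Rightarrow>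
     if j = i \<or> j = i + 4 then 0 else if j = i + 2 then if even i then u else 2 * inverse u else (1::'a))"
    for u :: 'a
  have c_val: "c u (i, i) = 0" "c u (i, i + 1) = 1" "c u (i, i + 2) = (if even i then u else 2 * inverse u)"
    "c u (i, i + 3) = 1" "c u (i, i + 4) = 0" for u i
    by (simp_all add: c_def frieze_indices_def)
  have c_val': "c u (i + 1, i + 2) = 1" "c u (i + 1, i + 3) = (if even i then 2 * inverse u else u)"
    "c u (i + 1, i + 4) = 1" for u i
    using c_val(2,3,4)[of u "i + 1"] by (simp_all add: add.assoc)
  have "c ` {u \<in> R. u \<noteq> 0 \<and> inverse u \<in> R} \<subseteq> nonzero_friezes 1 R"
  proof clarify
    fix u assume u: "u \<in> R" "u \<noteq> 0" "inverse u \<in> R"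
    have "c u (i, j) * c u (i + 1, j + 1) - c u (i, j + 1) * c u (i + 1, j) = 1"
      if "i + 1 \<le> j" "j \<le> int 1 + i + 2" for i j
    proof -
      have "j = i + 1 \<or> j = i + 2 \<or> j = i + 3" using that by auto
      then show ?thesis
        by (elim disjE) (use u in \<open>simp_all add: c_val c_val' add.assoc\<close>)
    qed
    moreover have "c u (i, j) \<in> R - {0}" if "i + 2 \<le> j" "j \<le> int 1 + i + 1" for i j
    proof -
      have "j = i + 2" using that by auto
      then show ?thesis using u two by (auto simp: c_def frieze_indices_def)
    qed
    moreover have "c u \<in> extensional (frieze_indices 1)" by (simp add: c_def)
    ultimately show "c u \<in> nonzero_friezes 1 R"
      by (auto simp: nonzero_friezes_def) (auto simp: c_def frieze_indices_def)
  qed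
  then have "finite (c ` {u \<in> R. u \<noteq> 0 \<and> inverse u \<in> R})"
    using fin by (rule finite_subset)
  moreover have "inj_on c {u \<in> R. u \<noteq> 0 \<and> inverse u \<in> R}"
  proof (rule inj_onI)
    fix u v assume "c u = c v"
    then have "c u (0, 2) = c v (0, 2)" by simp
    then show "u = v" by (simp add: c_def frieze_indices_def)
  qed
  ultimately show False using inf by (auto dest: finite_imageD)
qed

section \<open>Units in orders\<close>

definition zval :: "complex \<Rightarrow> nat \<Rightarrow> (nat \<Rightarrow> int) \<Rightarrow> complex" where
  "zval y d a = (\<Sum>i<d. of_int (a i) * y ^ i)"

definition zspan :: "complex \<Rightarrow> nat \<Rightarrow> complex set" where
  "zspan y d = range (zval y d)"

text \<open>\<open>zval\<close> depends on the first d values only; extensional functions represent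
  each coordinate vector once, so that they can be counted.\<close>

definition zcoords :: "nat \<Rightarrow> nat \<Rightarrow> (nat \<Rightarrow> int) set" where
  "zcoords d H = {..<d} \<rightarrow>\<^sub>E {- int H..int H}"

definition zbox :: "complex \<Rightarrow> nat \<Rightarrow> nat \<Rightarrow> complex set" where
  "zbox y d H = zval y d ` zcoords d H"

lemma zval_cong: "(\<And>i. i < d \<Longrightarrow> a i = b i) \<Longrightarrow> zval y d a = zval y d b"
  by (simp add: zval_def)

lemma zval_add: "zval y d (\<lambda>i. a i + b i) = zval y d a + zval y d b"
  by (simp add: zval_def algebra_simps sum.distrib)

lemma zval_diff: "zval y d (\<lambda>i. a i - b i) = zval y d a - zval y d b"
  by (simp add: zval_def algebra_simps sum_subtractf)

lemma zval_scale: "zval y d (\<lambda>i. k * a i) = of_int k * zval y d a"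
  by (simp add: zval_def sum_distrib_left mult.assoc)

lemma zval_sum: "zval y d (\<lambda>i. \<Sum>j\<in>J. f j i) = (\<Sum>j\<in>J. zval y d (f j))"
proof -
  have "zval y d (\<lambda>i. \<Sum>j\<in>J. f j i) = (\<Sum>i<d. \<Sum>j\<in>J. of_int (f j i) * y ^ i)"
    by (simp add: zval_def sum_distrib_right)
  also have "\<dots> = (\<Sum>j\<in>J. zval y d (f j))"
    unfolding zval_def by (rule sum.swap)
  finally show ?thesis .
qed

lemma zval_single: "j < d \<Longrightarrow> zval y d (\<lambda>i. if i = j then k else 0) = of_int k * y ^ j"
  by (simp add: zval_def if_distrib[of of_int] if_distrib[of "\<lambda>x. x * _"] cong: if_cong)

lemma zspan_add: "u \<in> zspan y d \<Longrightarrow> v \<in> zspan y d \<Longrightarrow> u + v \<in> zspan y d"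
  by (auto simp: zspan_def zval_add[symmetric])

lemma zspan_diff: "u \<in> zspan y d \<Longrightarrow> v \<in> zspan y d \<Longrightarrow> u - v \<in> zspan y d"
  by (auto simp: zspan_def zval_diff[symmetric])

lemma zspan_scale: "u \<in> zspan y d \<Longrightarrow> of_int k * u \<in> zspan y d"
  by (auto simp: zspan_def zval_scale[symmetric])

lemma zspan_sum: "(\<And>j. j \<in> J \<Longrightarrow> f j \<in> zspan y d) \<Longrightarrow> sum f J \<in> zspan y d"
proof (induction J rule: infinite_finite_induct)
  case (insert x F)
  then show ?case by (simp add: zspan_add)
qed (auto simp: zspan_def image_iff zval_def intro: exI[of _ "\<lambda>_. 0"])

lemma zspan_power: "i < d \<Longrightarrow> y ^ i \<in> zspan y d"
  unfolding zspan_def using zval_single[of i d y 1] by (metis mult_1 of_int_1 rangeI)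

lemma zspan_mult_generator:
  assumes reduce: "y ^ d \<in> zspan y d" and "v \<in> zspan y d"
  shows "y * v \<in> zspan y d"
proof -
  obtain a where a: "v = zval y d a" using assms by (auto simp: zspan_def)
  have "y * v = (\<Sum>i<d. of_int (a i) * y ^ Suc i)"
    by (simp add: a zval_def sum_distrib_left algebra_simps)
  also have "\<dots> \<in> zspan y d"
  proof (intro zspan_sum zspan_scale)
    fix i assume "i \<in> {..<d}"
    then consider "Suc i < d" | "Suc i = d" by fastforce
    then show "y ^ Suc i \<in> zspan y d" by cases (use reduce zspan_power in \<open>auto simp del: power_Suc\<close>)
  qed
  finally show ?thesis .
qed

lemma zspan_power_closed:
  assumes "y ^ d \<in> zspan y d" "0 < d"
  shows "y ^ k \<in> zspan y d"
  by (induction k) (use zspan_power[of 0 d y] assms zspan_mult_generator in auto)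

lemma zspan_mult_closed:
  assumes "y ^ d \<in> zspan y d" "u \<in> zspan y d" "v \<in> zspan y d"
  shows "u * v \<in> zspan y d"
proof -
  obtain a where a: "u = zval y d a" using assms by (auto simp: zspan_def)
  have "y ^ i * v \<in> zspan y d" for i
    by (induction i) (use assms zspan_mult_generator in \<open>auto simp: mult.assoc\<close>)
  then show ?thesis
    unfolding a zval_def sum_distrib_right mult.assoc by (intro zspan_sum zspan_scale)
qed

lemma zcoords_finite: "finite (zcoords d H)"
  by (auto simp: zcoords_def intro: finite_PiE)

lemma card_zcoords: "card (zcoords d H) = (2 * H + 1) ^ d"
proof -
  have "card {- int H..int H} = 2 * H + 1" by simp
  then show ?thesis unfolding zcoords_def by (subst card_PiE) auto
qed

lemma zboxI:
  assumes "\<And>i. i < d \<Longrightarrow> \<bar>a i\<bar> \<le> int H"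
  shows "zval y d a \<in> zbox y d H"
proof -
  have "restrict a {..<d} \<in> zcoords d H"
    using assms by (force simp: zcoords_def abs_le_iff)
  moreover have "zval y d a = zval y d (restrict a {..<d})"
    by (rule zval_cong) auto
  ultimately show ?thesis by (auto simp: zbox_def)
qed

lemma zboxE:
  assumes "v \<in> zbox y d H"
  obtains a where "v = zval y d a" "\<And>i. i < d \<Longrightarrow> \<bar>a i\<bar> \<le> int H"
proof -
  obtain a where a: "v = zval y d a" "a \<in> zcoords d H" using assms by (auto simp: zbox_def)
  have "\<bar>a i\<bar> \<le> int H" if "i < d" for i
  proof -
    have "a i \<in> {- int H..int H}"
      using a(2) that unfolding zcoords_def by (intro PiE_mem[of a "{..<d}"]) simp_all
    then show ?thesis by (simp add: abs_le_iff)
  qed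
  with a(1) show thesis by (rule that)
qed

lemma zbox_add:
  assumes "u \<in> zbox y d H" "v \<in> zbox y d Y"
  shows "u + v \<in> zbox y d (H + Y)"
proof -
  obtain a b where ab: "u = zval y d a" "v = zval y d b" "\<And>i. i < d \<Longrightarrow> \<bar>a i\<bar> \<le> int H"
    "\<And>i. i < d \<Longrightarrow> \<bar>b i\<bar> \<le> int Y"
    using assms by (metis zboxE)
  have "\<bar>a i + b i\<bar> \<le> int (H + Y)" if "i < d" for i
    using ab(3,4)[OF that] by linarith
  then show ?thesis unfolding ab(1,2) zval_add[symmetric] by (intro zboxI) auto
qed

lemma zbox_mono: "H \<le> Y \<Longrightarrow> zbox y d H \<subseteq> zbox y d Y"
  unfolding zbox_def zcoords_def by (intro image_mono PiE_mono) auto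

lemma zbox_of_nat: "0 < d \<Longrightarrow> n \<le> H \<Longrightarrow> of_nat n \<in> zbox y d H"
  using zboxI[of d "\<lambda>i. if i = 0 then int n else 0" H y] by (simp add: zval_single)

lemma zbox_subset_zspan: "zbox y d H \<subseteq> zspan y d"
  by (auto simp: zbox_def zspan_def)

lemma zbox_norm: "\<exists>C\<ge>1. \<forall>H. \<forall>v\<in>zbox y d H. norm v \<le> C * real H"
proof (intro exI[of _ "1 + (\<Sum>i<d. norm (y ^ i))"] conjI allI ballI)
  fix H v assume "v \<in> zbox y d H"
  then obtain a where a: "v = zval y d a" "\<And>i. i < d \<Longrightarrow> \<bar>a i\<bar> \<le> int H" by (metis zboxE)
  have "norm v \<le> (\<Sum>i<d. norm (of_int (a i) * y ^ i))"
    unfolding a(1) zval_def by (rule norm_sum)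
  also have "\<dots> \<le> (\<Sum>i<d. real H * norm (y ^ i))"
  proof (rule sum_mono)
    fix i assume "i \<in> {..<d}"
    then have "real_of_int \<bar>a i\<bar> \<le> real H" using a(2)[of i] by (metis lessThan_iff of_int_le_iff of_int_of_nat_eq)
    then show "norm (of_int (a i) * y ^ i) \<le> real H * norm (y ^ i)"
      unfolding norm_mult by (intro mult_right_mono) auto
  qed
  also have "\<dots> = (\<Sum>i<d. norm (y ^ i)) * real H"
    by (simp add: sum_distrib_left mult.commute)
  also have "\<dots> \<le> (1 + (\<Sum>i<d. norm (y ^ i))) * real H"
    by (intro mult_right_mono) auto
  finally show "norm v \<le> (1 + (\<Sum>i<d. norm (y ^ i))) * real H" .
qed (simp add: sum_nonneg)

text \<open>
  The exponent \<open>s\<close> is the real dimension of the region containing the values: an interval or a disc.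
\<close>

lemma close_pair:
  fixes f :: "'a \<Rightarrow> complex"
  assumes J: "finite J" and s: "s = 1 \<and> (\<forall>j\<in>J. Im (f j) = 0) \<or> s = 2"
    and bound: "\<And>j. j \<in> J \<Longrightarrow> norm (f j) \<le> \<rho>"
    and \<rho>: "\<rho> \<ge> 0" and \<delta>: "\<delta> > 0"
    and card: "real (card J) > (4 * \<rho> / \<delta> + 3) ^ s"
  obtains j k where "j \<in> J" "k \<in> J" "j \<noteq> k" "norm (f j - f k) \<le> \<delta>"
proof -
  \<comment> \<open>Grid cells of side \<delta>/2 are used, so two values in one cell are at
    distance at most \<delta>. Each direction has 2 N + 1 <= 4 \<rho>/\<delta> + 3 cells, and for
    real values the second direction is a single cell.\<close>
  define N where "N = \<lfloor>2 * \<rho> / \<delta>\<rfloor> + 1"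
  define g where "g j = (\<lfloor>2 * Re (f j) / \<delta>\<rfloor>, \<lfloor>2 * Im (f j) / \<delta>\<rfloor>)" for j
  define G where "G = {-N..N} \<times> (if s = 1 then {0} else {-N..N})"
  have N: "N \<ge> 1" using \<rho> \<delta> by (simp add: N_def)
  have fl: "\<lfloor>2 * x / \<delta>\<rfloor> \<in> {-N..N}" if "\<bar>x\<bar> \<le> \<rho>" for x
  proof -
    have "2 * x / \<delta> \<le> 2 * \<rho> / \<delta>" "- (2 * \<rho> / \<delta>) \<le> 2 * x / \<delta>"
      using that \<delta> by (auto simp: field_simps abs_le_iff)
    then show ?thesis unfolding N_def by (simp add: floor_mono) linarith
  qed
  have "g ` J \<subseteq> G"
  proof
    fix p assume "p \<in> g ` J"
    then obtain j where j: "j \<in> J" "p = g j" by auto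
    have "\<bar>Re (f j)\<bar> \<le> \<rho>" "\<bar>Im (f j)\<bar> \<le> \<rho>"
      using bound[OF j(1)] abs_Re_le_cmod abs_Im_le_cmod order_trans by blast+
    then show "p \<in> G" using fl s j by (auto simp: G_def g_def)
  qed
  moreover have "finite G" by (simp add: G_def)
  ultimately have "card (g ` J) \<le> card G" by (rule card_mono[rotated])
  also have "real (card G) = real_of_int (2 * N + 1) ^ s"
    using s N by (auto simp: G_def card_cartesian_product power2_eq_square)
  also have "\<dots> \<le> (4 * \<rho> / \<delta> + 3) ^ s"
  proof (rule power_mono)
    have "real_of_int \<lfloor>2 * \<rho> / \<delta>\<rfloor> \<le> 2 * \<rho> / \<delta>" by simp
    then have "2 * real_of_int \<lfloor>2 * \<rho> / \<delta>\<rfloor> \<le> 2 * (2 * \<rho> / \<delta>)" by linarith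
    then show "real_of_int (2 * N + 1) \<le> 4 * \<rho> / \<delta> + 3" by (simp add: N_def)
  qed (use N in simp)
  finally have "card (g ` J) < card J" using card by simp
  then have "\<not> inj_on g J" using card_image by force
  then obtain j k where jk: "j \<in> J" "k \<in> J" "j \<noteq> k" "g j = g k" by (auto simp: inj_on_def)
  have near: "\<bar>x - x'\<bar> \<le> \<delta> / 2" if "\<lfloor>2 * x / \<delta>\<rfloor> = \<lfloor>2 * x' / \<delta>\<rfloor>" for x x'
  proof -
    have "\<bar>2 * x / \<delta> - 2 * x' / \<delta>\<bar> \<le> 1" using that by linarith
    then have "\<bar>2 * x - 2 * x'\<bar> \<le> \<delta>"
      using \<delta> by (simp add: diff_divide_distrib[symmetric] pos_divide_le_eq)
    then show ?thesis by linarith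
  qed
  have "norm (f j - f k) \<le> \<bar>Re (f j - f k)\<bar> + \<bar>Im (f j - f k)\<bar>" by (rule cmod_le)
  also have "\<dots> \<le> \<delta> / 2 + \<delta> / 2"
    using near jk(4) by (intro add_mono) (auto simp: g_def)
  finally show thesis using that jk by simp
qed

text \<open>The ring Z[y] with additive basis 1, ..., y^(d-1), where \<open>s\<close> is the real
  dimension of the line or plane containing its values. \<open>s_less\<close> is Dirichlet's
  condition for infinitely many units: d >= 2 for real y, d >= 3 otherwise.\<close>

locale order_basis =
  fixes y :: complex and d s :: nat
  assumes reduce: "y ^ d \<in> zspan y d"
    and indep: "\<And>a. zval y d a = 0 \<Longrightarrow> \<forall>i<d. a i = 0"
    and dim: "s = 1 \<and> y \<in> \<real> \<or> s = 2 \<and> y \<notin> \<real>"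
    and s_less: "s < d"
begin

lemma d_pos: "0 < d" using s_less by simp

lemmas power_in_zspan = zspan_power_closed[OF reduce d_pos]
  and zspan_mult = zspan_mult_closed[OF reduce]

text \<open>Heights are multiplicative up to a constant, obtained by summing the structure
  constants: the absolute values of the coordinates of all products y^(i+j).\<close>

lemma zbox_mult: "\<exists>C. \<forall>H Y. \<forall>u\<in>zbox y d H. \<forall>v\<in>zbox y d Y. u * v \<in> zbox y d (C * H * Y)"
proof -
  have "\<forall>k. \<exists>r. y ^ k = zval y d r" using power_in_zspan by (auto simp: zspan_def)
  then obtain r where r: "\<And>k. y ^ k = zval y d (r k)" by metis
  define c where "c = (\<Sum>i<d. \<Sum>j<d. \<Sum>l<d. \<bar>r (i + j) l\<bar>)"
  have "u * v \<in> zbox y d (nat c * H * Y)" if uv: "u \<in> zbox y d H" "v \<in> zbox y d Y" for H Y u v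
  proof -
    obtain a b where ab: "u = zval y d a" "v = zval y d b" "\<And>i. i < d \<Longrightarrow> \<bar>a i\<bar> \<le> int H"
      "\<And>i. i < d \<Longrightarrow> \<bar>b i\<bar> \<le> int Y"
      using uv by (metis zboxE)
    have "u * v = (\<Sum>i<d. \<Sum>j<d. of_int (a i * b j) * y ^ (i + j))"
      by (simp add: ab(1,2) zval_def sum_product power_add algebra_simps)
    also have "\<dots> = zval y d (\<lambda>l. \<Sum>i<d. \<Sum>j<d. a i * b j * r (i + j) l)"
      unfolding r by (simp only: zval_sum zval_scale)
    also have "\<dots> \<in> zbox y d (nat c * H * Y)"
    proof (rule zboxI)
      fix l assume l: "l < d"
      have "\<bar>\<Sum>i<d. \<Sum>j<d. a i * b j * r (i + j) l\<bar> \<le> (\<Sum>i<d. \<bar>\<Sum>j<d. a i * b j * r (i + j) l\<bar>)"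
        by (rule sum_abs)
      also have "\<dots> \<le> (\<Sum>i<d. \<Sum>j<d. \<bar>a i * b j * r (i + j) l\<bar>)"
        by (intro sum_mono sum_abs)
      also have "\<dots> \<le> (\<Sum>i<d. \<Sum>j<d. int H * int Y * (\<Sum>l<d. \<bar>r (i + j) l\<bar>))"
        unfolding abs_mult
      proof (intro sum_mono mult_mono)
        show "\<bar>r (i + j) l\<bar> \<le> (\<Sum>l<d. \<bar>r (i + j) l\<bar>)" for i j
          using l by (intro member_le_sum) auto
      qed (use ab in auto)
      also have "\<dots> = int H * int Y * c"
        by (simp add: c_def sum_distrib_left)
      also have "\<dots> = int (nat c * H * Y)"
        by (simp add: c_def sum_nonneg)
      finally show "\<bar>\<Sum>i<d. \<Sum>j<d. a i * b j * r (i + j) l\<bar> \<le> int (nat c * H * Y)" .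
    qed
    finally show ?thesis .
  qed
  then show ?thesis by blast
qed

lemma zval_inj:
  assumes "a \<in> zcoords d H" "b \<in> zcoords d H'" "zval y d a = zval y d b"
  shows "a = b"
proof -
  have "zval y d (\<lambda>i. a i - b i) = 0" using assms(3) by (simp add: zval_diff)
  then have "\<forall>i<d. a i = b i" using indep by fastforce
  then show ?thesis
    using assms(1,2) unfolding zcoords_def by (intro extensionalityI[of a "{..<d}" b]) (auto simp: PiE_def)
qed

text \<open>The number 1, or the pair 1, y for non-real y, is linearly independent over the reals,
  so the first s powers span a discrete group.\<close>

lemma leading_discrete: "\<exists>\<delta>>0. \<delta> \<le> 1 \<and> (\<forall>m. norm (zval y s m) \<le> \<delta> \<longrightarrow> (\<forall>i<s. m i = 0))"
  using dim
proof
  assume s: "s = 1 \<and> y \<in> \<real>"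
  show ?thesis
  proof (intro exI[of _ "1/2"] conjI allI impI)
    fix m i assume "norm (zval y s m) \<le> 1 / 2" "i < s"
    then have "real_of_int \<bar>m 0\<bar> \<le> 1 / 2" "i = 0" using s by (auto simp: zval_def)
    then have "m 0 = 0" by linarith
    with \<open>i = 0\<close> show "m i = 0" by simp
  qed auto
next
  assume s: "s = 2 \<and> y \<notin> \<real>"
  then have y: "Im y \<noteq> 0" using complex_is_Real_iff by blast
  define \<delta> where "\<delta> = min (1/2) (\<bar>Im y\<bar> / 2)"
  have \<delta>: "\<delta> > 0" "\<delta> \<le> 1/2" "\<delta> < \<bar>Im y\<bar>" using y by (auto simp: \<delta>_def min_def)
  show ?thesis
  proof (intro exI[of _ \<delta>] conjI allI impI)
    fix m i assume m: "norm (zval y s m) \<le> \<delta>" "i < s"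
    have v: "zval y s m = of_int (m 0) + of_int (m 1) * y"
      using s by (simp add: zval_def numeral_2_eq_2)
    have "\<bar>Im (zval y s m)\<bar> \<le> \<delta>" "\<bar>Re (zval y s m)\<bar> \<le> \<delta>"
      using m(1) abs_Im_le_cmod abs_Re_le_cmod order_trans by blast+
    then have Im: "\<bar>real_of_int (m 1)\<bar> * \<bar>Im y\<bar> \<le> \<delta>"
      and Re: "\<bar>of_int (m 0) + of_int (m 1) * Re y\<bar> \<le> \<delta>"
      by (simp_all add: v abs_mult)
    have "m 1 = 0"
    proof (rule ccontr)
      assume "m 1 \<noteq> 0"
      then have "1 * \<bar>Im y\<bar> \<le> \<bar>real_of_int (m 1)\<bar> * \<bar>Im y\<bar>" by (intro mult_right_mono) linarith+
      with Im \<delta> show False by linarith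
    qed
    moreover from this Re \<delta> have "real_of_int \<bar>m 0\<bar> < 1" by simp
    then have "m 0 = 0" by linarith
    moreover have "i = 0 \<or> i = 1" using m s by auto
    ultimately show "m i = 0" by auto
  qed (use \<delta> in auto)
qed

lemma Im_zval: "s = 1 \<Longrightarrow> Im (zval y d a) = 0"
  using dim by (auto simp: zval_def intro!: sum.neutral simp: complex_is_Real_iff[symmetric] Reals_mult Reals_power)

text \<open>The last d - s coordinates have O(H^(d-s)) choices. Once they are fixed, values differ
  by elements of the discrete group of \<open>leading_discrete\<close>, so only O(Y^s) of them have
  absolute value at most Y: more would contain a pair that is too close by
  \<open>close_pair\<close>.\<close>

lemma zbox_count:
  "\<exists>K>0. \<forall>H\<ge>1. \<forall>Y\<ge>1. real (card {v \<in> zbox y d H. norm v \<le> Y}) \<le> K * real H ^ (d - s) * Y ^ s"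
proof -
  obtain \<delta> where \<delta>: "\<delta> > 0" "\<delta> \<le> 1" and disc: "\<And>m. norm (zval y s m) \<le> \<delta> \<Longrightarrow> \<forall>i<s. m i = 0"
    using leading_discrete by blast
  define K where "K = 3 ^ (d - s) * (4 / \<delta> + 3) ^ s"
  have "real (card {v \<in> zbox y d H. norm v \<le> Y}) \<le> K * real H ^ (d - s) * Y ^ s"
    if H: "H \<ge> 1" and Y: "Y \<ge> 1" for H Y
  proof -
    define V where "V = {a \<in> zcoords d H. norm (zval y d a) \<le> Y}"
    define t where "t a = restrict a {s..<d}" for a :: "nat \<Rightarrow> int"
    have V: "finite V" by (simp add: V_def zcoords_finite)
    have fibre: "real (card {a \<in> V. t a = b}) \<le> (4 * Y / \<delta> + 3) ^ s" for b
    proof (rule ccontr)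
      assume "\<not> ?thesis"
      then have big: "real (card {a \<in> V. t a = b}) > (4 * Y / \<delta> + 3) ^ s" by simp
      have "s = 1 \<and> (\<forall>j\<in>{a \<in> V. t a = b}. Im (zval y d j) = 0) \<or> s = 2"
        using dim Im_zval by auto
      note dims = this
      obtain a a' where a: "a \<in> V" "t a = b" "a' \<in> V" "t a' = b" "a \<noteq> a'"
        and close: "norm (zval y d a - zval y d a') \<le> \<delta>"
      proof (rule close_pair[OF _ dims _ _ \<delta>(1) big], goal_cases)
        case 1
        show ?case using V by simp
      next
        case (4 a a')
        then show ?case using that[of a a'] by simp
      qed (use Y in \<open>auto simp: V_def\<close>)
      have tail: "a i = a' i" if "s \<le> i" "i < d" for i
        using a(2,4) that unfolding t_def by (metis atLeastLessThan_iff restrict_apply')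
      have "zval y d a - zval y d a' = (\<Sum>i<d. of_int (a i - a' i) * y ^ i)"
        unfolding zval_diff[symmetric] by (simp add: zval_def)
      also have "\<dots> = (\<Sum>i<s. of_int (a i - a' i) * y ^ i)"
        using s_less tail by (intro sum.mono_neutral_right) auto
      also have "\<dots> = zval y s (\<lambda>i. a i - a' i)"
        by (simp add: zval_def)
      finally have "\<forall>i<s. a i - a' i = 0" using disc[of "\<lambda>i. a i - a' i"] close by simp
      then have "a i = a' i" if "i < d" for i using tail[of i] that by (cases "i < s") auto
      then have "a = a'"
        using a(1,3) unfolding V_def zcoords_def by (intro extensionalityI[of a "{..<d}" a']) (auto simp: PiE_def)
      with a(5) show False by simp
    qed
    have img: "t ` V \<subseteq> {s..<d} \<rightarrow>\<^sub>E {- int H..int H}"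
      by (auto simp: V_def t_def zcoords_def PiE_iff)
    have "card (t ` V) \<le> card ({s..<d} \<rightarrow>\<^sub>E {- int H..int H})"
      by (intro card_mono img finite_PiE) auto
    also have "\<dots> = (2 * H + 1) ^ (d - s)"
    proof -
      have "card {- int H..int H} = 2 * H + 1" by simp
      then show ?thesis by (subst card_PiE) auto
    qed
    also have "\<dots> \<le> (3 * H) ^ (d - s)"
      using H by (intro power_mono) auto
    finally have tV: "real (card (t ` V)) \<le> real ((3 * H) ^ (d - s))" by (simp only: of_nat_le_iff)
    have "{v \<in> zbox y d H. norm v \<le> Y} = zval y d ` V" by (auto simp: zbox_def V_def)
    then have "real (card {v \<in> zbox y d H. norm v \<le> Y}) \<le> real (card V)"
      by (simp add: card_image_le V)
    also have "card V = (\<Sum>b\<in>t ` V. card {a \<in> V. t a = b})"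
      using sum.image_gen[OF V, of "\<lambda>_. 1::nat" t] by simp
    also have "real \<dots> = (\<Sum>b\<in>t ` V. real (card {a \<in> V. t a = b}))" by simp
    also have "\<dots> \<le> (\<Sum>b\<in>t ` V. (4 * Y / \<delta> + 3) ^ s)" by (intro sum_mono fibre)
    also have "\<dots> = real (card (t ` V)) * (4 * Y / \<delta> + 3) ^ s" by simp
    also have "\<dots> \<le> real ((3 * H) ^ (d - s)) * ((4 / \<delta> + 3) * Y) ^ s"
    proof (intro mult_mono power_mono tV)
      show "4 * Y / \<delta> + 3 \<le> (4 / \<delta> + 3) * Y" using Y by (simp add: distrib_right)
    qed (use Y \<delta> in auto)
    also have "\<dots> = K * real H ^ (d - s) * Y ^ s"
      by (simp add: K_def power_mult_distrib)
    finally show ?thesis .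
  qed
  moreover have "K > 0" using \<delta> by (auto simp: K_def intro!: mult_pos_pos zero_less_power add_pos_pos)
  ultimately show ?thesis by blast
qed

text \<open>Pigeonhole on the values of more than h^(s d) coordinate vectors. Coordinates up to H
  produce a difference of size about H^(1 - d/s); H = h^s turns the exponent into the integer s -
  d.\<close>

lemma small_element:
  "\<exists>C>0. \<forall>h\<ge>7. \<exists>z\<in>zbox y d (h ^ s). z \<noteq> 0 \<and> norm z * real h ^ (d - s) \<le> C"
proof -
  obtain C where C: "C \<ge> 1" "\<And>H v. v \<in> zbox y d H \<Longrightarrow> norm v \<le> C * real H"
    using zbox_norm[of y d] by blast
  have "\<exists>z\<in>zbox y d (h ^ s). z \<noteq> 0 \<and> norm z * real h ^ (d - s) \<le> 7 * C" if h: "h \<ge> 7" for h :: nat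
  proof -
    define J where "J = {..<d} \<rightarrow>\<^sub>E {0..int (h ^ s)}"
    have J: "finite J" unfolding J_def by (intro finite_PiE) auto
    have JZ: "J \<subseteq> zcoords d (h ^ s)" unfolding J_def zcoords_def by (intro PiE_mono) auto
    have card: "card J = (h ^ s + 1) ^ d"
    proof -
      have "card {0..int (h ^ s)} = h ^ s + 1" by (simp del: of_nat_power)
      then show ?thesis unfolding J_def by (subst card_PiE) auto
    qed
    have hd: "7 \<le> real h ^ d"
    proof -
      have "7 \<le> h ^ d" using h d_pos self_le_power[of h d] by linarith
      then show ?thesis by (metis of_nat_le_iff of_nat_numeral of_nat_power)
    qed
    define \<rho> where "\<rho> = C * real (h ^ s)"
    \<comment> \<open>The 7 absorbs the additive 3 of \<open>close_pair\<close>: 4 \<rho>/\<delta> +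
      3 = 4 h^d / 7 + 3 is at most h^d because h^d >= 7.\<close>
    define \<delta> where "\<delta> = 7 * \<rho> / real h ^ d"
    have \<rho>: "\<rho> > 0" using C(1) h by (simp add: \<rho>_def)
    have \<delta>: "\<delta> > 0" using \<rho> h by (simp add: \<delta>_def)
    have "4 * \<rho> / \<delta> + 3 = 4 * real h ^ d / 7 + 3"
      using \<rho> h by (simp add: \<delta>_def field_simps)
    also have "\<dots> \<le> real h ^ d" using hd by simp
    finally have "(4 * \<rho> / \<delta> + 3) ^ s \<le> (real h ^ d) ^ s"
      using \<rho> \<delta> by (intro power_mono) auto
    also have "\<dots> = real ((h ^ s) ^ d)" by (simp add: power_mult[symmetric] mult.commute)
    also have "\<dots> < real (card J)"
      unfolding card of_nat_less_iff using d_pos by (intro power_strict_mono) auto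
    finally have big: "real (card J) > (4 * \<rho> / \<delta> + 3) ^ s" .
    have bound: "norm (zval y d j) \<le> \<rho>" if "j \<in> J" for j
      unfolding \<rho>_def using that JZ by (intro C(2)) (auto simp: zbox_def)
    have "s = 1 \<and> (\<forall>j\<in>J. Im (zval y d j) = 0) \<or> s = 2"
      using dim Im_zval by auto
    note dims = this
    obtain a b where ab: "a \<in> J" "b \<in> J" "a \<noteq> b" "norm (zval y d a - zval y d b) \<le> \<delta>"
      by (rule close_pair[OF J dims bound less_imp_le[OF \<rho>] \<delta> big])
    define z where "z = zval y d a - zval y d b"
    have "z \<in> zbox y d (h ^ s)"
      unfolding z_def zval_diff[symmetric]
    proof (rule zboxI)
      fix i assume "i < d"
      then have "a i \<in> {0..int (h ^ s)}" "b i \<in> {0..int (h ^ s)}"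
        using ab(1,2) by (auto simp: J_def PiE_iff)
      then show "\<bar>a i - b i\<bar> \<le> int (h ^ s)" by (auto simp: abs_le_iff)
    qed
    moreover have "z \<noteq> 0" using zval_inj[of a "h ^ s" b "h ^ s"] ab JZ by (auto simp: z_def)
    moreover have "norm z * real h ^ (d - s) \<le> 7 * C"
    proof -
      have "real h ^ d = real h ^ (d - s) * real h ^ s"
        using s_less by (simp add: power_add[symmetric])
      then have "\<delta> * real h ^ (d - s) = 7 * C"
        using h by (simp add: \<delta>_def \<rho>_def)
      then show ?thesis using ab(4) mult_right_mono[of "norm z" \<delta> "real h ^ (d - s)"]
        by (simp add: z_def)
    qed
    ultimately show ?thesis by blast
  qed
  then show ?thesis using C(1) by (intro exI[of _ "7 * C"]) auto
qed

text \<open>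
  Counting the elements \<open>i + z w\<close> with \<open>i \<le> M\<close> bounds the order of 1 in the quotient by the ideal
  generated by \<open>z\<close>; this replaces the computation of the norm of \<open>z\<close>.
\<close>

lemma small_divisor:
  "\<exists>M C. M \<ge> 1 \<and> (\<forall>h\<ge>7. \<exists>z\<in>zspan y d. z \<noteq> 0 \<and> norm z * real h ^ (d - s) \<le> C \<and>
     (\<exists>m\<in>{1..M}. \<exists>t\<in>zspan y d. z * t = of_nat m))"
proof -
  obtain C1 where C1: "C1 > 0"
    "\<And>h. h \<ge> 7 \<Longrightarrow> \<exists>z\<in>zbox y d (h ^ s). z \<noteq> 0 \<and> norm z * real h ^ (d - s) \<le> C1"
    using small_element by blast
  obtain C where C: "\<And>H Y u v. u \<in> zbox y d H \<Longrightarrow> v \<in> zbox y d Y \<Longrightarrow> u * v \<in> zbox y d (C * H * Y)"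
    using zbox_mult by blast
  obtain C4 where C4: "C4 \<ge> 1" "\<And>H v. v \<in> zbox y d H \<Longrightarrow> norm v \<le> C4 * real H"
    using zbox_norm[of y d] by blast
  obtain K where K: "K > 0" "\<And>H Y. H \<ge> 1 \<Longrightarrow> Y \<ge> 1 \<Longrightarrow>
      real (card {v \<in> zbox y d H. norm v \<le> Y}) \<le> K * real H ^ (d - s) * Y ^ s"
    using zbox_count by blast
  define Q where "Q = K * real (1 + C) ^ (d - s) * (1 + C1 * C4) ^ s"
  define M where "M = nat \<lceil>Q\<rceil> + 1"
  have M: "M \<ge> 1" "real M + 1 > Q" by (simp_all add: M_def) linarith
  have "\<exists>z\<in>zspan y d. z \<noteq> 0 \<and> norm z * real h ^ (d - s) \<le> C1 \<and>
      (\<exists>m\<in>{1..M}. \<exists>t\<in>zspan y d. z * t = of_nat m)" if h: "h \<ge> 7" for h :: nat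
  proof -
    obtain z where z: "z \<in> zbox y d (h ^ s)" "z \<noteq> 0" "norm z * real h ^ (d - s) \<le> C1"
      using C1(2)[OF h] by blast
    \<comment> \<open>The parameters make both sides of the count proportional to T^d. For w of
      height T, the element i + z w has height at most H, and its absolute value is at most Y, free
      of h, because |z| h^(d-s) <= C1. So at most K H^(d-s) Y^s = Q T^d values face at least (M + 1)
      T^d pairs, and M, chosen from Q alone, works for every h.\<close>
    define T where "T = M * h ^ (d - s)"
    define H where "H = (1 + C) * M * h ^ d"
    define Y where "Y = (1 + C1 * C4) * real M"
    define \<phi> where "\<phi> = (\<lambda>(i, b). of_nat i + z * zval y d b)"
    define P where "P = {0..M} \<times> zcoords d T"
    have H: "H \<ge> 1" using M h by (simp add: H_def)
    have Y: "Y \<ge> 1"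
      using M(1) C1(1) C4(1) mult_mono[of 1 "1 + C1 * C4" 1 "real M"] by (simp add: Y_def)
    have hdh: "h ^ s * h ^ (d - s) = h ^ d" using s_less by (simp add: power_add[symmetric])
    have "\<phi> ` P \<subseteq> {v \<in> zbox y d H. norm v \<le> Y}"
    proof
      fix v assume "v \<in> \<phi> ` P"
      then obtain i b where ib: "i \<le> M" "b \<in> zcoords d T" "v = of_nat i + z * zval y d b"
        by (auto simp: \<phi>_def P_def)
      have b: "zval y d b \<in> zbox y d T" using ib by (auto simp: zbox_def)
      have "v \<in> zbox y d (M + C * h ^ s * T)"
        unfolding ib(3) by (intro zbox_add zbox_of_nat C z b ib d_pos)
      moreover have "M + C * h ^ s * T \<le> H"
      proof -
        have "C * h ^ s * T = C * M * h ^ d" by (simp add: T_def hdh[symmetric])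
        moreover have "M * 1 \<le> M * h ^ d" using h by (intro mult_le_mono2) simp
        moreover have "H = M * h ^ d + C * M * h ^ d" by (simp add: H_def algebra_simps)
        ultimately show ?thesis by linarith
      qed
      ultimately have "v \<in> zbox y d H" using zbox_mono by blast
      moreover have "norm v \<le> Y"
      proof -
        have "norm v \<le> norm (of_nat i :: complex) + norm z * norm (zval y d b)"
          unfolding ib(3) norm_mult[symmetric] by (rule norm_triangle_ineq)
        also have "\<dots> \<le> real M + norm z * (C4 * real T)"
          using ib(1) C4(2)[OF b] by (intro add_mono mult_left_mono) auto
        also have "norm z * (C4 * real T) = (norm z * real h ^ (d - s)) * (C4 * real M)"
          by (simp add: T_def)
        also have "\<dots> \<le> C1 * (C4 * real M)" using z(3) C4(1) by (intro mult_right_mono) auto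
        finally show ?thesis by (simp add: Y_def algebra_simps)
      qed
      ultimately show "v \<in> {v \<in> zbox y d H. norm v \<le> Y}" by simp
    qed
    moreover have "finite {v \<in> zbox y d H. norm v \<le> Y}"
      by (simp add: zbox_def zcoords_finite)
    ultimately have "real (card (\<phi> ` P)) \<le> real (card {v \<in> zbox y d H. norm v \<le> Y})"
      by (simp add: card_mono)
    also have "\<dots> \<le> K * real H ^ (d - s) * Y ^ s" by (rule K(2)[OF H Y])
    also have "\<dots> = Q * (real M ^ (d - s) * real M ^ s) * real (h ^ d) ^ (d - s)"
    proof -
      have "real H = real (1 + C) * real M * real (h ^ d)" unfolding H_def by (simp only: of_nat_mult)
      then show ?thesis by (simp only: Q_def Y_def power_mult_distrib mult_ac)
    qed
    also have "real M ^ (d - s) * real M ^ s = real M ^ d"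
      using s_less by (simp add: power_add[symmetric])
    also have "Q * real M ^ d * real (h ^ d) ^ (d - s) = Q * real T ^ d"
      by (simp add: T_def power_mult_distrib power_mult[symmetric] mult.commute)
    also have "\<dots> < (real M + 1) * real T ^ d"
      using M h by (intro mult_strict_right_mono) (auto simp: T_def)
    also have "\<dots> \<le> (real M + 1) * real (2 * T + 1) ^ d"
      by (intro mult_left_mono power_mono) auto
    also have "\<dots> = real (card P)"
      by (simp add: P_def card_cartesian_product card_zcoords distrib_right)
    finally have "card (\<phi> ` P) < card P" by simp
    then have "\<not> inj_on \<phi> P" using card_image by force
    then obtain i b i' b' where col: "(i, b) \<in> P" "(i', b') \<in> P" "(i, b) \<noteq> (i', b')"
      "of_nat i + z * zval y d b = of_nat i' + z * zval y d b'"
      by (auto simp: inj_on_def \<phi>_def)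
    have eq: "z * (zval y d b' - zval y d b) = of_nat i - of_nat i'"
      using col(4) by (simp add: algebra_simps)
    have "i \<noteq> i'"
    proof
      assume "i = i'"
      with eq z have "zval y d b' = zval y d b" by simp
      then have "b' = b" using col zval_inj by (auto simp: P_def)
      with \<open>i = i'\<close> col(3) show False by simp
    qed
    have span: "zval y d b \<in> zspan y d" "zval y d b' \<in> zspan y d" by (auto simp: zspan_def)
    have "\<exists>m\<in>{1..M}. \<exists>t\<in>zspan y d. z * t = of_nat m"
    proof (cases "i > i'")
      case True
      with eq span col show ?thesis
        by (intro bexI[of _ "i - i'"] bexI[of _ "zval y d b' - zval y d b"] zspan_diff)
           (auto simp: P_def of_nat_diff)
    next
      case False
      with eq span col \<open>i \<noteq> i'\<close> show ?thesis
        by (intro bexI[of _ "i' - i"] bexI[of _ "zval y d b - zval y d b'"] zspan_diff)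
           (auto simp: P_def of_nat_diff algebra_simps)
    qed
    with z zbox_subset_zspan show ?thesis by blast
  qed
  with M(1) show ?thesis by blast
qed

text \<open>Each m <= M divides Q = M!, so the elements of \<open>small_divisor\<close> all divide
  Q, and there are infinitely many since their absolute values tend to 0. If two of them, z and w,
  have coordinates congruent modulo Q and w t = Q, then z = w + Q q = w (1 + t q). By symmetry z / w
  is a unit.\<close>

lemma infinite_units: "infinite {u \<in> zspan y d. u \<noteq> 0 \<and> inverse u \<in> zspan y d}"
proof -
  obtain M C where M: "M \<ge> (1::nat)" and small: "\<And>h. h \<ge> 7 \<Longrightarrow> \<exists>z\<in>zspan y d. z \<noteq> 0 \<and>
      norm z * real h ^ (d - s) \<le> C \<and> (\<exists>m\<in>{1..M}. \<exists>t\<in>zspan y d. z * t = of_nat m)"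
    using small_divisor by blast
  define Q :: int where "Q = fact M"
  have Q: "Q > 0" by (simp add: Q_def)
  define Z where "Z = {z \<in> zspan y d. z \<noteq> 0 \<and> (\<exists>t\<in>zspan y d. z * t = of_int Q)}"
  have infZ: "infinite Z"
  proof
    assume fin: "finite Z"
    define e where "e = Min (insert 1 (norm ` Z))"
    have e: "e > 0" using fin by (auto simp: e_def Z_def)
    define h where "h = nat \<lceil>C / e\<rceil> + 7"
    have h: "h \<ge> 7" "real h > C / e" by (simp_all add: h_def) linarith
    obtain z m t where z: "z \<in> zspan y d" "z \<noteq> 0" "norm z * real h ^ (d - s) \<le> C"
      "m \<in> {1..M}" "t \<in> zspan y d" "z * t = of_nat m"
      using small[OF h(1)] by blast
    obtain k where "fact M = m * k" using z(4) dvd_fact[of m M] by (auto elim: dvdE)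
    then have "Q = int m * int k"
      unfolding Q_def by (metis of_nat_fact of_nat_mult)
    then have "z * (of_int (int k) * t) = of_int Q"
      using z(6) by (simp add: algebra_simps)
    then have "z \<in> Z" using z zspan_scale[OF z(5), of "int k"] unfolding Z_def by blast
    then have "e \<le> norm z" using fin by (simp add: e_def)
    then have "e * real h \<le> norm z * real h" by (intro mult_right_mono) auto
    also have "\<dots> \<le> norm z * real h ^ (d - s)"
      using s_less h self_le_power[of "real h" "d - s"] by (intro mult_left_mono) auto
    also have "\<dots> \<le> C" by (rule z)
    finally show False using h(2) e by (simp add: field_simps)
  qed
  have "\<exists>a. z = zval y d a" if "z \<in> Z" for z using that by (auto simp: Z_def zspan_def)
  then obtain a where a: "\<And>z. z \<in> Z \<Longrightarrow> z = zval y d (a z)" by metis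
  define \<kappa> where "\<kappa> z = (\<lambda>i\<in>{..<d}. a z i mod Q)" for z
  have "\<kappa> ` Z \<subseteq> {..<d} \<rightarrow>\<^sub>E {0..<Q}" 
  proof (rule image_subsetI)
    show "\<kappa> z \<in> {..<d} \<rightarrow>\<^sub>E {0..<Q}" for z
      unfolding \<kappa>_def using Q by (simp add: restrict_PiE_iff)
  qed
  then have "finite (\<kappa> ` Z)" by (rule finite_subset) (intro finite_PiE, auto)
  from pigeonhole_infinite[OF infZ this] obtain z0
    where z0: "z0 \<in> Z" "infinite {z \<in> Z. \<kappa> z = \<kappa> z0}" by blast
  have quot: "z / w \<in> zspan y d" if zw: "z \<in> Z" "w \<in> Z" "\<kappa> z = \<kappa> w" for z w
  proof -
    have "\<exists>q. a z i - a w i = Q * q" if "i < d" for i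
    proof -
      have "a z i mod Q = a w i mod Q"
        using fun_cong[OF zw(3), of i] that by (simp add: \<kappa>_def)
      then show ?thesis by (metis dvdE mod_eq_dvd_iff)
    qed
    then obtain q where q: "\<And>i. i < d \<Longrightarrow> a z i - a w i = Q * q i" by metis
    have "z - w = zval y d (\<lambda>i. a z i - a w i)" using a zw by (simp add: zval_diff)
    also have "\<dots> = zval y d (\<lambda>i. Q * q i)" using q by (intro zval_cong)
    also have "\<dots> = of_int Q * zval y d q" by (rule zval_scale)
    finally have diff: "z = w + of_int Q * zval y d q" by (simp add: algebra_simps)
    obtain t where t: "t \<in> zspan y d" "w * t = of_int Q" "w \<noteq> 0" using zw by (auto simp: Z_def)
    have "z / w = 1 + t * zval y d q"
      unfolding diff using t(3) by (simp add: t(2)[symmetric] field_simps)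
    also have "\<dots> \<in> zspan y d"
      using power_in_zspan[of 0] t(1) by (intro zspan_add zspan_mult) (auto simp: zspan_def)
    finally show ?thesis .
  qed
  have "inj_on (\<lambda>z. z / z0) {z \<in> Z. \<kappa> z = \<kappa> z0}"
    using z0(1) by (auto simp: inj_on_def Z_def)
  then have "infinite ((\<lambda>z. z / z0) ` {z \<in> Z. \<kappa> z = \<kappa> z0})"
    using z0(2) finite_imageD by blast
  moreover have "(\<lambda>z. z / z0) ` {z \<in> Z. \<kappa> z = \<kappa> z0} \<subseteq> {u \<in> zspan y d. u \<noteq> 0 \<and> inverse u \<in> zspan y d}"
  proof (rule image_subsetI)
    fix z assume "z \<in> {z \<in> Z. \<kappa> z = \<kappa> z0}"
    then have z: "z \<in> Z" "\<kappa> z = \<kappa> z0" by auto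
    then have "z \<noteq> 0" "z0 \<noteq> 0" using z0(1) by (auto simp: Z_def)
    with quot[OF z(1) z0(1) z(2)] quot[OF z0(1) z(1) z(2)[symmetric]]
    show "z / z0 \<in> {u \<in> zspan y d. u \<noteq> 0 \<and> inverse u \<in> zspan y d}" by simp
  qed
  ultimately show ?thesis using infinite_super by blast
qed

end

section \<open>Imaginary quadratic numbers\<close>

text \<open>A monic integral equation read as a reduction of y^n to lower powers. Its degree n is
  arbitrary, so one reducible power already makes y integral.\<close>

lemma algebraic_int_iff_zspan: "algebraic_int y \<longleftrightarrow> (\<exists>n>0. y ^ n \<in> zspan y n)"
proof
  assume "algebraic_int y"
  then obtain p where p: "poly (map_poly of_int p) y = 0" "lead_coeff p = 1"
    by (auto simp: algebraic_int_altdef_ipoly)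
  define n where "n = degree p"
  have "0 = (\<Sum>i\<le>n. of_int (coeff p i) * y ^ i)"
    using p(1) by (simp add: poly_altdef n_def degree_map_poly coeff_map_poly)
  also have "\<dots> = y ^ n - zval y n (\<lambda>i. - coeff p i)"
    using p(2) by (simp add: zval_def n_def lessThan_Suc_atMost[symmetric] sum_negf)
  finally have eq: "y ^ n = zval y n (\<lambda>i. - coeff p i)" by simp
  moreover have "n \<noteq> 0"
  proof
    assume "n = 0"
    with eq show False by (simp add: zval_def)
  qed
  ultimately show "\<exists>n>0. y ^ n \<in> zspan y n" by (auto simp: zspan_def)
next
  assume "\<exists>n>0. y ^ n \<in> zspan y n"
  then obtain n a where n: "n > 0" "y ^ n = zval y n a" by (auto simp: zspan_def)
  define q :: "complex poly" where "q = (\<Sum>i<n. monom (of_int (- a i)) i)"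
  have dq: "degree q < degree (monom (1::complex) n)"
    unfolding q_def degree_monom_eq[OF one_neq_zero] using n(1)
    by (intro degree_sum_less) (auto intro: le_less_trans[OF degree_monom_le])
  have "poly (monom 1 n + q) y = y ^ n + (\<Sum>i<n. of_int (- a i) * y ^ i)"
    by (simp add: q_def poly_monom poly_sum)
  also have "\<dots> = 0" by (simp add: n(2) zval_def sum_negf)
  finally have "poly (monom 1 n + q) y = 0" .
  moreover have "coeff (monom 1 n + q) i \<in> \<int>" for i
    by (simp add: q_def coeff_sum)
  moreover have "lead_coeff (monom 1 n + q) = 1"
    using dq degree_add_eq_left[OF dq] by (simp add: degree_monom_eq coeff_eq_0)
  ultimately show "algebraic_int y" using algebraic_int.intros by blast
qed

text \<open>If n is the denominator of u in lowest terms, then n^k divides q for every k, which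
  forces n = 1.\<close>

lemma Rats_bounded_denominators:
  fixes u :: real
  assumes "u \<in> \<rat>" "q \<noteq> 0" "\<And>k. of_int q * u ^ k \<in> \<int>"
  shows "u \<in> \<int>"
proof -
  obtain m n where mn: "n > 0" "coprime m n" "u = of_int m / of_int n"
    using assms(1) by (metis Rats_cases')
  have dvd: "n ^ k dvd q" for k
  proof -
    obtain w where "of_int q * u ^ k = of_int w" using assms(3) by (auto elim: Ints_cases)
    then have "real_of_int (q * m ^ k) = real_of_int (w * n ^ k)"
      using mn by (simp add: power_divide field_simps)
    then have "n ^ k dvd q * m ^ k" by (simp only: of_int_eq_iff) simp
    moreover have "coprime (n ^ k) (m ^ k)" using mn(2) by (simp add: coprime_commute)
    ultimately show ?thesis by (simp add: coprime_dvd_mult_left_iff)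
  qed
  have "n = 1"
  proof (rule ccontr)
    assume "n \<noteq> 1"
    with mn have "n \<ge> 2" by simp
    define k where "k = nat \<bar>q\<bar>"
    have "int k < 2 ^ k" by (metis less_exp of_nat_less_iff of_nat_numeral of_nat_power)
    also have "\<dots> \<le> n ^ k" using \<open>n \<ge> 2\<close> by (intro power_mono) auto
    also have "\<dots> \<le> \<bar>q\<bar>" using dvd[of k] assms(2) by (simp add: dvd_imp_le_int zdvd_imp_le)
    finally show False by (simp add: k_def)
  qed
  with mn show ?thesis by simp
qed

text \<open>The leading coefficient \<open>c\<close> may differ from 1, so y may fail to be
  integral. The multiple \<theta> = c y is integral, and Z[\<theta>] is the discrete ring with which
  the spans of powers of y are compared.\<close>

locale imaginary_quadratic =
  fixes y :: complex and a b c :: int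
  assumes c: "c \<noteq> 0" and root: "of_int c * y\<^sup>2 + of_int b * y + of_int a = 0" and y: "y \<notin> \<real>"
begin

lemma Im_y: "Im y \<noteq> 0" using y complex_is_Real_iff by blast

lemma trace: "of_int c * (2 * Re y) = - of_int b"
proof -
  have "Im (of_int c * y\<^sup>2 + of_int b * y + of_int a) = 0" by (simp add: root)
  then have "Im y * (of_int c * (2 * Re y) + of_int b) = 0"
    by (simp add: power2_eq_square algebra_simps)
  with Im_y show ?thesis by simp
qed

lemma norm: "of_int c * (cmod y)\<^sup>2 = of_int a"
proof -
  have "Re (of_int c * y\<^sup>2 + of_int b * y + of_int a) = 0" by (simp add: root)
  then have "of_int c * ((Re y)\<^sup>2 - (Im y)\<^sup>2) + of_int b * Re y + of_int a = 0"
    by (simp add: power2_eq_square algebra_simps)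
  moreover have "of_int b = - (of_int c * (2 * Re y))" using trace by simp
  ultimately show ?thesis
    unfolding cmod_power2 by (simp add: power2_eq_square algebra_simps)
qed

definition \<theta> :: complex where "\<theta> = of_int c * y"

definition order :: "complex set" where "order = zspan \<theta> 2"

lemma zval_2: "zval x 2 m = of_int (m 0) + of_int (m 1) * x"
  by (simp add: zval_def numeral_2_eq_2)

lemma orderI: "of_int m + of_int n * \<theta> \<in> order"
proof -
  have "of_int m + of_int n * \<theta> = zval \<theta> 2 (\<lambda>i. if i = 0 then m else n)"
    by (simp add: zval_2)
  then show ?thesis by (simp only: order_def zspan_def rangeI)
qed

lemma orderE:
  assumes "x \<in> order"
  obtains m n where "x = of_int m + of_int n * \<theta>"
  using assms zval_2 by (auto simp: order_def zspan_def)

lemma Im_\<theta>: "Im \<theta> \<noteq> 0"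
  using Im_y c by (simp add: \<theta>_def)

lemma \<theta>_power2: "\<theta>\<^sup>2 = - of_int b * \<theta> - of_int (a * c)"
proof -
  have "\<theta>\<^sup>2 + of_int b * \<theta> + of_int (a * c) = of_int c * (of_int c * y\<^sup>2 + of_int b * y + of_int a)"
    by (simp add: \<theta>_def power2_eq_square algebra_simps)
  then have "\<theta>\<^sup>2 + of_int b * \<theta> + of_int (a * c) = 0" by (simp only: root mult_zero_right)
  moreover have "\<theta>\<^sup>2 = (\<theta>\<^sup>2 + of_int b * \<theta> + of_int (a * c)) - of_int b * \<theta> - of_int (a * c)"
    by simp
  ultimately show ?thesis by simp
qed

lemma \<theta>_reduce: "\<theta> ^ 2 \<in> zspan \<theta> 2"
proof -
  have "\<theta> ^ 2 = of_int (- (a * c)) + of_int (- b) * \<theta>" by (simp add: \<theta>_power2)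
  then show ?thesis using orderI by (metis order_def)
qed

text \<open>For i <= k one has c^k y^i = c^(k-i) \<theta>^i.\<close>

lemma zspan_denominator:
  assumes "x \<in> zspan y (Suc k)"
  shows "of_int c ^ k * x \<in> order"
proof -
  obtain m where m: "x = zval y (Suc k) m" using assms by (auto simp: zspan_def)
  have "of_int c ^ k * x = (\<Sum>i<Suc k. of_int (m i * c ^ (k - i)) * \<theta> ^ i)"
    unfolding m zval_def sum_distrib_left
  proof (rule sum.cong)
    fix i assume "i \<in> {..<Suc k}"
    then have "(of_int c :: complex) ^ k = of_int c ^ (k - i) * of_int c ^ i"
      by (simp add: power_add[symmetric])
    then show "of_int c ^ k * (of_int (m i) * y ^ i) = of_int (m i * c ^ (k - i)) * \<theta> ^ i"
      by (simp add: \<theta>_def power_mult_distrib algebra_simps)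
  qed simp
  also have "\<dots> \<in> order"
    unfolding order_def by (intro zspan_sum zspan_scale zspan_power_closed[OF \<theta>_reduce]) simp
  finally show ?thesis .
qed

lemma order_norm:
  assumes "x \<in> order"
  shows "(cmod x)\<^sup>2 \<in> \<int>"
proof -
  obtain m n where x: "x = of_int m + of_int n * \<theta>" using assms by (elim orderE)
  have "(cmod x)\<^sup>2 = of_int (m\<^sup>2) + of_int (m * n) * (of_int c * (2 * Re y)) +
      of_int (n\<^sup>2 * c) * (of_int c * (cmod y)\<^sup>2)"
    unfolding cmod_power2 by (simp add: x \<theta>_def power2_eq_square algebra_simps)
  also have "\<dots> = of_int (m\<^sup>2 - m * n * b + n\<^sup>2 * c * a)"
    unfolding trace norm by simp
  finally show ?thesis by simp
qed

text \<open>For integral y some span of 1, ..., y^n is a ring, so the single factor c^n clears the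
  denominators of all powers of an element v. The powers of |v|^2 then have bounded denominators,
  and \<open>Rats_bounded_denominators\<close> applies. Taking v = y gives the norm, v = 1 + y in
  addition the trace.\<close>

lemma integral_trace_norm:
  assumes "algebraic_int y"
  shows "2 * Re y \<in> \<int>" "(cmod y)\<^sup>2 \<in> \<int>"
proof -
  obtain n where n: "y ^ Suc n \<in> zspan y (Suc n)"
    using assms unfolding algebraic_int_iff_zspan by (metis gr0_implies_Suc)
  have Re: "2 * Re y = - of_int b / of_int c"
    using trace c by (simp add: field_simps)
  have norm_y: "(cmod y)\<^sup>2 = of_int a / of_int c"
    using norm c by (simp add: field_simps)
  have int: "(cmod v)\<^sup>2 \<in> \<int>" if v: "v \<in> zspan y (Suc n)" and rat: "(cmod v)\<^sup>2 \<in> \<rat>" for v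
  proof (rule Rats_bounded_denominators[OF rat])
    fix k
    have "v ^ k \<in> zspan y (Suc n)"
    proof (induction k)
      case 0
      show ?case using zspan_power[of 0 "Suc n" y] by simp
    next
      case (Suc k)
      then show ?case using zspan_mult_closed[OF n v] by simp
    qed
    then have "(cmod (of_int c ^ n * v ^ k))\<^sup>2 \<in> \<int>" by (intro order_norm zspan_denominator)
    also have "(cmod (of_int c ^ n * v ^ k))\<^sup>2 = of_int ((c ^ n)\<^sup>2) * ((cmod v)\<^sup>2) ^ k"
    proof -
      have "cmod (of_int c ^ n) = \<bar>of_int (c ^ n)\<bar>" by (simp add: norm_power power_abs)
      moreover have "(cmod (v ^ k))\<^sup>2 = ((cmod v)\<^sup>2) ^ k"
        by (simp add: norm_power power_mult[symmetric] mult.commute)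
      ultimately show ?thesis by (simp add: norm_mult power_mult_distrib)
    qed
    finally show "of_int ((c ^ n)\<^sup>2) * ((cmod v)\<^sup>2) ^ k \<in> \<int>" .
  qed (use c in simp)
  have span: "1 \<in> zspan y (Suc n)" "y \<in> zspan y (Suc n)"
    using zspan_power_closed[OF n, of 0] zspan_power_closed[OF n, of 1] by auto
  show N: "(cmod y)\<^sup>2 \<in> \<int>"
    using norm_y by (intro int span) auto
  have sq: "(cmod (1 + y))\<^sup>2 = 1 + 2 * Re y + (cmod y)\<^sup>2"
    unfolding cmod_power2 by (simp add: power2_eq_square algebra_simps)
  have "(cmod (1 + y))\<^sup>2 \<in> \<int>"
    unfolding sq[symmetric] using sq Re norm_y by (intro int zspan_add span) auto
  then have "(cmod (1 + y))\<^sup>2 - (cmod y)\<^sup>2 - 1 \<in> \<int>" using N by (intro Ints_diff) auto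
  then show "2 * Re y \<in> \<int>" by (simp add: sq)
qed

lemma order_finite: "finite {x \<in> order. cmod x \<le> r}"
proof -
  define B where "B = \<lceil>r / \<bar>Im \<theta>\<bar>\<rceil>"
  define B' where "B' = \<lceil>r + \<bar>of_int B\<bar> * \<bar>Re \<theta>\<bar>\<rceil>"
  have "{x \<in> order. cmod x \<le> r} \<subseteq> (\<lambda>(m, n). of_int m + of_int n * \<theta>) ` ({-B'..B'} \<times> {-B..B})"
  proof clarify
    fix x assume x: "x \<in> order" "cmod x \<le> r"
    obtain m n where mn: "x = of_int m + of_int n * \<theta>" using x(1) by (elim orderE)
    have Im: "\<bar>of_int n\<bar> * \<bar>Im \<theta>\<bar> \<le> r" and Re: "\<bar>of_int m + of_int n * Re \<theta>\<bar> \<le> r"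
      using x(2) abs_Im_le_cmod[of x] abs_Re_le_cmod[of x] by (auto simp: mn abs_mult)
    have "\<bar>of_int n\<bar> \<le> r / \<bar>Im \<theta>\<bar>" using Im Im_\<theta> by (simp add: pos_le_divide_eq)
    then have "real_of_int \<bar>n\<bar> \<le> of_int B" unfolding B_def by linarith
    then have n: "\<bar>n\<bar> \<le> B" by linarith
    have "\<bar>of_int m\<bar> \<le> r + \<bar>of_int n * Re \<theta>\<bar>" using Re by linarith
    also have "\<bar>of_int n * Re \<theta>\<bar> \<le> \<bar>of_int B\<bar> * \<bar>Re \<theta>\<bar>"
      unfolding abs_mult using n by (intro mult_right_mono) linarith+
    finally have "real_of_int \<bar>m\<bar> \<le> of_int B'" unfolding B'_def by linarith
    then have "\<bar>m\<bar> \<le> B'" by linarith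
    with n mn show "x \<in> (\<lambda>(m, n). of_int m + of_int n * \<theta>) ` ({-B'..B'} \<times> {-B..B})"
      by (intro image_eqI[of _ _ "(m, n)"]) auto
  qed
  then show ?thesis by (rule finite_subset) auto
qed

lemma order_approx: "\<exists>w\<in>order. cmod (x - w) \<le> 1 + cmod \<theta>"
proof -
  define n where "n = \<lfloor>Im x / Im \<theta>\<rfloor>"
  define m where "m = \<lfloor>Re x - (Im x / Im \<theta>) * Re \<theta>\<rfloor>"
  define p where "p = Im x / Im \<theta> - of_int n"
  define q where "q = Re x - (Im x / Im \<theta>) * Re \<theta> - of_int m"
  have pq: "\<bar>p\<bar> \<le> 1" "\<bar>q\<bar> \<le> 1" unfolding p_def q_def n_def m_def by linarith+
  have "x - (of_int m + of_int n * \<theta>) = of_real q + of_real p * \<theta>"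
    using Im_\<theta> by (simp add: complex_eq_iff p_def q_def algebra_simps)
  also have "cmod \<dots> \<le> \<bar>q\<bar> + \<bar>p\<bar> * cmod \<theta>"
    by (metis norm_mult norm_of_real norm_triangle_ineq)
  also have "\<dots> \<le> 1 + 1 * cmod \<theta>"
    using pq by (intro add_mono mult_right_mono) auto
  finally show ?thesis using orderI[of m n] by auto
qed

text \<open>Multiplication by \<theta> shifts the powers of y and threatens to leave the span only
  at y^k, where c y^(k+1) = - b y^k - a y^(k-1). The last power explains k >= 1.\<close>

lemma \<theta>_mult_zspan:
  assumes "k \<ge> 1" "x \<in> zspan y (Suc k)"
  shows "\<theta> * x \<in> zspan y (Suc k)"
proof -
  obtain m where m: "x = zval y (Suc k) m" using assms by (auto simp: zspan_def)
  have "\<theta> * y ^ i \<in> zspan y (Suc k)" if "i < Suc k" for i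
  proof (cases "i = k")
    case True
    have "\<theta> * y ^ k = of_int c * y\<^sup>2 * y ^ (k - 1)"
      using assms(1) by (simp add: \<theta>_def power_eq_if power2_eq_square)
    also have "of_int c * y\<^sup>2 = - of_int b * y - of_int a"
    proof -
      have "of_int c * y\<^sup>2 = (of_int c * y\<^sup>2 + of_int b * y + of_int a) - of_int b * y - of_int a"
        by simp
      then show ?thesis by (simp only: root) simp
    qed
    also have "(- of_int b * y - of_int a) * y ^ (k - 1) = of_int (- b) * y ^ k - of_int a * y ^ (k - 1)"
      using assms(1) by (simp add: algebra_simps power_eq_if)
    also have "\<dots> \<in> zspan y (Suc k)" by (intro zspan_diff zspan_scale zspan_power) auto
    finally show ?thesis using True by simp
  next
    case False
    then have "of_int c * y ^ Suc i \<in> zspan y (Suc k)"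
      using that by (intro zspan_scale zspan_power) simp
    then show ?thesis by (simp add: \<theta>_def mult.assoc)
  qed
  then show ?thesis
    unfolding m zval_def sum_distrib_left mult.left_commute[of \<theta>]
    by (intro zspan_sum zspan_scale) auto
qed

text \<open>Multiplication by c^k maps the span into the discrete ring \<open>order\<close>, so only
  finitely many vectors compete with the vector 1.\<close>

lemma ex_shortest:
  "\<exists>z\<in>zspan y (Suc k). z \<noteq> 0 \<and> (\<forall>x\<in>zspan y (Suc k). x \<noteq> 0 \<longrightarrow> cmod z \<le> cmod x)"
proof -
  define V where "V = {x \<in> zspan y (Suc k). x \<noteq> 0 \<and> cmod x \<le> 1}"
  have "(\<lambda>x. of_int c ^ k * x) ` V \<subseteq> {x \<in> order. cmod x \<le> cmod (of_int c ^ k)}"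
    using mult_left_le[of "cmod _" "cmod (of_int c ^ k)"]
    by (auto simp: V_def zspan_denominator norm_mult simp del: norm_power)
  then have "finite ((\<lambda>x. of_int c ^ k * x) ` V)"
    using order_finite by (rule finite_subset)
  moreover have "inj_on (\<lambda>x. of_int c ^ k * x) V"
    using c by (auto simp: inj_on_def)
  ultimately have fin: "finite V" by (rule finite_imageD)
  have one: "1 \<in> V" using zspan_power[of 0 "Suc k" y] by (simp add: V_def)
  define z where "z = arg_min_on cmod V"
  have z: "z \<in> V" "\<And>x. x \<in> V \<Longrightarrow> cmod z \<le> cmod x"
    using arg_min_if_finite[OF fin, of cmod] one unfolding z_def by (auto simp: not_less)
  have "cmod z \<le> cmod x" if "x \<in> zspan y (Suc k)" "x \<noteq> 0" for x
  proof (cases "cmod x \<le> 1")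
    case True
    with that z(2) show ?thesis by (simp add: V_def)
  next
    case False
    with z(1) show ?thesis by (simp add: V_def)
  qed
  with z(1) show ?thesis by (auto simp: V_def)
qed

text \<open>
  The lattices spanned by the powers of \<open>y\<close> are modules over the order. Scaled by their shortest vectors,
  they fall into finitely many classes, and the quotient of two scaling factors in a class is a unit.
\<close>

lemma nonintegral_infinite_units:
  assumes "\<not> algebraic_int y"
  shows "infinite {u \<in> \<Union> (range (zspan y)). u \<noteq> 0 \<and> inverse u \<in> \<Union> (range (zspan y))}"
proof -
  obtain z where z: "\<And>k. z k \<in> zspan y (Suc k)" "\<And>k. z k \<noteq> 0"
    "\<And>k x. x \<in> zspan y (Suc k) \<Longrightarrow> x \<noteq> 0 \<Longrightarrow> cmod (z k) \<le> cmod x"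
    using ex_shortest by metis
  \<comment> \<open>After scaling, L k contains 1, and its non-zero elements have length at least
    1.\<close>
  define L where "L k = (\<lambda>x. x / z k) ` zspan y (Suc k)" for k
  have L_diff: "u - v \<in> L k" if "u \<in> L k" "v \<in> L k" for u v k
    using that by (auto simp: L_def diff_divide_distrib[symmetric] intro!: imageI zspan_diff)
  have L_add: "u + v \<in> L k" if "u \<in> L k" "v \<in> L k" for u v k
    using that by (auto simp: L_def add_divide_distrib[symmetric] intro!: imageI zspan_add)
  have L_scale: "of_int m * u \<in> L k" if u: "u \<in> L k" for m u k
  proof -
    obtain x where "x \<in> zspan y (Suc k)" "u = x / z k" using u by (auto simp: L_def)
    then have "of_int m * u = (of_int m * x) / z k" "of_int m * x \<in> zspan y (Suc k)"
      by (simp_all add: zspan_scale)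
    then show ?thesis unfolding L_def by blast
  qed
  have L_one: "1 \<in> L k" for k using z(1,2)[of k] by (auto simp: L_def image_iff)
  have L_\<theta>: "\<theta> * u \<in> L k" if u: "u \<in> L k" and k: "k \<ge> 1" for u k
  proof -
    obtain x where "x \<in> zspan y (Suc k)" "u = x / z k" using u by (auto simp: L_def)
    then have "\<theta> * u = (\<theta> * x) / z k" "\<theta> * x \<in> zspan y (Suc k)"
      using k by (simp_all add: \<theta>_mult_zspan)
    then show ?thesis unfolding L_def by blast
  qed
  have L_order: "order \<subseteq> L k" if k: "k \<ge> 1" for k
  proof
    fix x assume "x \<in> order"
    then obtain m n where "x = of_int m * 1 + of_int n * (\<theta> * 1)" by (elim orderE) auto
    then show "x \<in> L k" using L_one L_\<theta>[OF _ k] L_scale L_add by metis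
  qed
  have L_ge1: "cmod u \<ge> 1" if "u \<in> L k" "u \<noteq> 0" for u k
    using that z(2)[of k] z(3)[of _ k] by (auto simp: L_def norm_divide)
  \<comment> \<open>Reduce each multiple j u by a nearby element of \<open>order\<close>: the
    remainders lie in a disc of radius 1 + |\<theta>|. Two of M + 1 remainders are at distance at
    most 1/2, hence equal, so some i u with 1 <= i <= M lies in \<open>order\<close>. The bound M
    does not depend on k.\<close>
  define M where "M = nat \<lceil>(4 * (1 + cmod \<theta>) / (1 / 2) + 3) ^ 2\<rceil>"
  have mult: "\<exists>i\<in>{1..M}. of_nat i * u \<in> order" if u: "u \<in> L k" and k: "k \<ge> 1" for u k
  proof -
    have "\<forall>j::nat. \<exists>w. w \<in> order \<and> cmod (of_nat j * u - w) \<le> 1 + cmod \<theta>"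
      using order_approx by blast
    then obtain w where w: "\<And>j. w j \<in> order" "\<And>j::nat. cmod (of_nat j * u - w j) \<le> 1 + cmod \<theta>"
      by metis
    have "real (card {0..M}) > (4 * (1 + cmod \<theta>) / (1 / 2) + 3) ^ 2"
      unfolding M_def by simp linarith
    then obtain i j where ij: "i \<le> M" "j \<le> M" "i \<noteq> j"
      "cmod ((of_nat i * u - w i) - (of_nat j * u - w j)) \<le> 1 / 2"
      using close_pair[of "{0..M}" 2 "\<lambda>j. of_nat j * u - w j" "1 + cmod \<theta>" "1/2"] w(2) by auto
    have "(of_nat i * u - w i) - (of_nat j * u - w j) \<in> L k"
      using u w(1) L_order[OF k] L_scale[of u k "int i"] L_scale[of u k "int j"]
      by (intro L_diff) auto
    with L_ge1 ij(4) have "(of_nat i * u - w i) - (of_nat j * u - w j) = 0"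
      by fastforce
    then have eq: "of_nat i * u - of_nat j * u = w i - w j" by (simp add: algebra_simps)
    have diff: "w i - w j \<in> order" "w j - w i \<in> order"
      using w(1) unfolding order_def by (auto intro: zspan_diff)
    show ?thesis
    proof (cases "i > j")
      case True
      then have "of_nat (i - j) * u = w i - w j" using eq by (simp add: of_nat_diff algebra_simps)
      with True ij diff show ?thesis by (intro bexI[of _ "i - j"]) auto
    next
      case False
      then have "of_nat (j - i) * u = w j - w i"
        using eq by (simp add: of_nat_diff algebra_simps)
      with False ij diff show ?thesis by (intro bexI[of _ "j - i"]) auto
    qed
  qed
  define Q :: int where "Q = fact M"
  have Q: "Q > 0" by (simp add: Q_def)
  have LQ: "of_int Q * u \<in> order" if u: "u \<in> L k" "k \<ge> 1" for u k
  proof -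
    obtain i where i: "i \<in> {1..M}" "of_nat i * u \<in> order" using mult u by blast
    then obtain e where "fact M = i * e" using dvd_fact[of i M] by (auto elim: dvdE)
    then have "Q = int e * int i" unfolding Q_def by (metis mult.commute of_nat_fact of_nat_mult)
    then have "of_int Q * u = of_int (int e) * (of_nat i * u)" by simp
    also have "\<dots> \<in> order" using i(2) unfolding order_def by (rule zspan_scale)
    finally show ?thesis .
  qed
  \<comment> \<open>L k lies between \<open>order\<close> and its multiple by 1/Q, so it is
    determined by its image in the finite quotient of the larger lattice by the smaller.
    \<open>N k\<close> records this image in coordinates modulo Q.\<close>
  define N where "N k = {(m mod Q, n mod Q) |m n. (of_int m + of_int n * \<theta>) / of_int Q \<in> L k}" for k
  have LN: "L k \<subseteq> L l" if kl: "k \<ge> 1" "l \<ge> 1" and N: "N k = N l" for k l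
  proof
    fix u assume u: "u \<in> L k"
    obtain m n where mn: "of_int Q * u = of_int m + of_int n * \<theta>"
      using LQ[OF u kl(1)] by (elim orderE)
    then have u_eq: "u = (of_int m + of_int n * \<theta>) / of_int Q"
      using Q by (simp add: field_simps)
    have "(m mod Q, n mod Q) \<in> N k" using u unfolding N_def u_eq by blast
    then obtain m' n' where mn': "m mod Q = m' mod Q" "n mod Q = n' mod Q"
      "(of_int m' + of_int n' * \<theta>) / of_int Q \<in> L l" unfolding N by (auto simp: N_def)
    then obtain p q where pq: "m = m' + Q * p" "n = n' + Q * q"
      by (metis mod_eqE)
    have "u = (of_int m' + of_int n' * \<theta>) / of_int Q + (of_int p + of_int q * \<theta>)"
      unfolding u_eq pq using Q by (simp add: field_simps)
    with mn'(3) L_order[OF kl(2)] orderI[of p q] show "u \<in> L l" using L_add by auto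
  qed
  have "N ` {1..} \<subseteq> Pow ({0..<Q} \<times> {0..<Q})" using Q by (auto simp: N_def)
  then have "finite (N ` {1..})" by (rule finite_subset) auto
  then obtain k0 where k0: "k0 \<in> {1..}" "infinite {k \<in> {1..}. N k = N k0}"
    using pigeonhole_infinite[of "{1::nat..}" N] infinite_Ici by blast
  define D where "D = {k \<in> {1..}. N k = N k0}"
  \<comment> \<open>The number 1 lies in every span, so 1 / z l lies in L l and hence in L k, which
    puts z k / z l into a span of powers of y. By symmetry it is a unit of the union of all
    spans.\<close>
  have quot: "z k / z l \<in> zspan y (Suc k)" if "k \<in> D" "l \<in> D" for k l
  proof -
    have "1 / z l \<in> L l" using zspan_power[of 0 "Suc l" y] by (auto simp: L_def)
    then have "1 / z l \<in> L k" using LN[of l k] that by (auto simp: D_def)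
    then obtain x where "x \<in> zspan y (Suc k)" "1 / z l = x / z k" by (auto simp: L_def)
    then show ?thesis using z(2) by (simp add: field_simps)
  qed
  \<comment> \<open>Equal scaling factors for k < l would put y^(k+1), which lies in the larger
    span, into the span of 1, ..., y^k and make y integral.\<close>
  have inj: "inj_on z D"
  proof (rule linorder_inj_onI)
    fix k l assume kl: "k < l" "k \<in> D" "l \<in> D"
    show "z k \<noteq> z l"
    proof
      assume eq: "z k = z l"
      have "y ^ Suc k / z l \<in> L l"
        using kl by (auto simp: L_def simp del: power_Suc intro!: imageI zspan_power)
      then have "y ^ Suc k / z l \<in> L k" using LN[of l k] kl by (auto simp: D_def)
      then have "y ^ Suc k \<in> zspan y (Suc k)" using z(2) by (auto simp: L_def eq[symmetric] simp del: power_Suc)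
      with assms show False unfolding algebraic_int_iff_zspan by blast
    qed
  qed auto
  have "inj_on (\<lambda>k. z k / z k0) D" using inj z(2)[of k0] by (auto simp: inj_on_def)
  then have "infinite ((\<lambda>k. z k / z k0) ` D)" using k0(2) finite_imageD unfolding D_def by blast
  moreover have "(\<lambda>k. z k / z k0) ` D \<subseteq> {u \<in> \<Union> (range (zspan y)). u \<noteq> 0 \<and> inverse u \<in> \<Union> (range (zspan y))}"
  proof (rule image_subsetI)
    fix k assume k: "k \<in> D"
    have "k0 \<in> D" using k0 by (simp add: D_def)
    with k quot[of k k0] quot[of k0 k] z(2)
    show "z k / z k0 \<in> {u \<in> \<Union> (range (zspan y)). u \<noteq> 0 \<and> inverse u \<in> \<Union> (range (zspan y))}"
      by auto
  qed
  ultimately show ?thesis using infinite_super by blast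
qed

end

section \<open>Rings with finitely many units\<close>

lemma complex_ring_simps [simp]:
  "carrier complex_ring = UNIV" "x \<otimes>\<^bsub>complex_ring\<^esub> y = x * y" "\<one>\<^bsub>complex_ring\<^esub> = 1"
  "\<zero>\<^bsub>complex_ring\<^esub> = 0" "x \<oplus>\<^bsub>complex_ring\<^esub> y = x + y"
  by (simp_all add: ring_of_type_algebra_def)

interpretation complex_ring: cring complex_ring
  by (rule cring_from_type_algebra)

lemma complex_ring_a_inv [simp]: "\<ominus>\<^bsub>complex_ring\<^esub> x = - x"
  by (rule complex_ring.minus_equality) auto

lemma complex_ring_inv: "x \<noteq> 0 \<Longrightarrow> inv\<^bsub>complex_ring\<^esub> x = inverse x"
  by (rule complex_ring.comm_inv_char) auto

lemma subring_complex_closed: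
  assumes "subring S complex_ring"
  shows "0 \<in> S" "1 \<in> S" "x \<in> S \<Longrightarrow> - x \<in> S" "x \<in> S \<Longrightarrow> y \<in> S \<Longrightarrow> x + y \<in> S"
    "x \<in> S \<Longrightarrow> y \<in> S \<Longrightarrow> x - y \<in> S" "x \<in> S \<Longrightarrow> y \<in> S \<Longrightarrow> x * y \<in> S"
proof -
  note E = subringE[OF assms, simplified]
  show "0 \<in> S" "1 \<in> S" "x \<in> S \<Longrightarrow> - x \<in> S" "x \<in> S \<Longrightarrow> y \<in> S \<Longrightarrow> x + y \<in> S"
    "x \<in> S \<Longrightarrow> y \<in> S \<Longrightarrow> x * y \<in> S"
    using E by auto
  show "x - y \<in> S" if "x \<in> S" "y \<in> S"
    using E(7)[OF that(1) E(5)[OF that(2)]] by simp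
qed

lemma subring_complex_of_int:
  assumes "subring S complex_ring"
  shows "of_int k \<in> S"
proof (induction k rule: int_induct[where k = 0])
  case base
  show ?case using subring_complex_closed(1)[OF assms] by simp
next
  case (step1 i)
  then show ?case using subring_complex_closed(2,4)[OF assms] by simp
next
  case (step2 i)
  then show ?case using subring_complex_closed(2,5)[OF assms] by simp
qed

lemma subring_complex_power:
  assumes "subring S complex_ring" "x \<in> S"
  shows "x ^ k \<in> S"
  by (induction k) (use subring_complex_closed[OF assms(1)] assms(2) in auto)

lemma zspan_subset_subring:
  assumes S: "subring S complex_ring" and "y \<in> S"
  shows "zspan y d \<subseteq> S"
proof
  fix x assume "x \<in> zspan y d"
  then obtain a where a: "x = zval y d a" by (auto simp: zspan_def)
  have "(\<Sum>i<d. of_int (a i) * y ^ i) \<in> S"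
    by (induction d) (use subring_complex_closed[OF S] subring_complex_of_int[OF S]
        subring_complex_power[OF S \<open>y \<in> S\<close>] in auto)
  then show "x \<in> S" by (simp add: a zval_def)
qed

lemma infinite_units_mono:
  assumes "infinite {u \<in> A. u \<noteq> 0 \<and> inverse u \<in> A}" "A \<subseteq> B"
  shows "infinite {u \<in> B. u \<noteq> 0 \<and> inverse u \<in> B}"
  using assms(1) by (rule infinite_super[rotated]) (use assms(2) in auto)

text \<open>Bezout's identity turns a fraction m / n in lowest terms into 1 / n, so the powers of n
  are units.\<close>

lemma Rats_infinite_units:
  assumes S: "subring S complex_ring" and x: "x \<in> S" "x \<in> \<rat>" "x \<notin> \<int>"
  shows "infinite {u \<in> S. u \<noteq> 0 \<and> inverse u \<in> S}"
proof -
  obtain m n where mn: "n > 0" "coprime m n" "x = of_int m / of_int n"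
    using x(2) by (metis Rats_cases')
  have n: "n \<ge> 2"
    using mn x(3) by (cases "n = 1") auto
  obtain u v where uv: "u * m + v * n = 1"
    using mn(2) by (metis bezout_int coprime_imp_gcd_eq_1)
  have "inverse (of_int n) = of_int u * x + of_int v"
  proof -
    have "(of_int u * x + of_int v) * of_int n = of_int (u * m + v * n)"
    proof -
      have "x * of_int n = of_int m" using mn by simp
      then show ?thesis by (simp add: distrib_right mult.assoc)
    qed
    also have "\<dots> = 1" by (simp add: uv)
    finally show ?thesis by (metis inverse_unique mult.commute)
  qed
  then have inv: "inverse (of_int n) \<in> S"
    using subring_complex_closed[OF S] subring_complex_of_int[OF S] x(1) by simp
  have "range (\<lambda>k. (of_int n :: complex) ^ k) \<subseteq> {u \<in> S. u \<noteq> 0 \<and> inverse u \<in> S}"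
    using mn(1) subring_complex_power[OF S inv] subring_complex_power[OF S subring_complex_of_int[OF S]]
    by (auto simp: power_inverse)
  moreover have "inj (\<lambda>k. (of_int n :: complex) ^ k)"
  proof (rule injI)
    fix j k assume "(of_int n :: complex) ^ j = of_int n ^ k"
    then have "n ^ j = n ^ k" by (metis of_int_eq_iff of_int_power)
    then show "j = k" using n by simp
  qed
  ultimately show ?thesis
    using range_inj_infinite infinite_super by blast
qed

lemma ex_min_int_poly:
  fixes x :: complex
  assumes "algebraic x"
  obtains p :: "int poly" where "p \<noteq> 0" "poly (map_poly of_int p) x = 0"
    "\<And>q :: int poly. poly (map_poly of_int q) x = 0 \<Longrightarrow> degree q < degree p \<Longrightarrow> q = 0"
proof -
  obtain p0 where p0: "\<And>i. coeff p0 i \<in> \<int>" "p0 \<noteq> 0" "poly p0 x = 0"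
    using assms unfolding algebraic_def by blast
  obtain p1 where p1: "p0 = map_poly of_int p1"
    using p0(1) by (rule intpolyE)
  let ?P = "\<lambda>p :: int poly. p \<noteq> 0 \<and> poly (map_poly of_int p) x = 0"
  have "?P p1" using p0 p1 by auto
  then obtain p where "?P p" "\<And>q. degree q < degree p \<Longrightarrow> \<not> ?P q"
    using ex_has_least_nat[of ?P p1 degree] by (metis not_le)
  then show thesis using that by blast
qed

text \<open>Multiplying the minimal equation by l^(d-1), with l its leading coefficient, gives a
  monic equation for l x. A linear relation among 1, ..., (l x)^(d-1) would be an equation for x of
  smaller degree.\<close>

lemma order_basis_leading_multiple:
  fixes p :: "int poly"
  assumes p: "p \<noteq> 0" "poly (map_poly of_int p) x = 0"
    and min: "\<And>q :: int poly. poly (map_poly of_int q) x = 0 \<Longrightarrow> degree q < degree p \<Longrightarrow> q = 0"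
    and dim: "s = 1 \<and> x \<in> \<real> \<or> s = 2 \<and> x \<notin> \<real>" and s: "s < degree p"
  shows "order_basis (of_int (lead_coeff p) * x) (degree p) s"
proof
  define l d y where "l = lead_coeff p" and "d = degree p" and "y = of_int l * x"
  have l: "l \<noteq> 0" using p by (simp add: l_def)
  have "0 = of_int (l ^ (d - 1)) * (\<Sum>i\<le>d. of_int (coeff p i) * x ^ i)"
    using p(2) by (simp add: poly_altdef d_def degree_map_poly coeff_map_poly)
  also have "\<dots> = (\<Sum>i\<le>d. of_int (l ^ (d - 1) * coeff p i) * x ^ i)"
    by (simp add: sum_distrib_left mult.assoc)
  also have "\<dots> = (\<Sum>i<d. of_int (l ^ (d - 1) * coeff p i) * x ^ i) + y ^ d"
  proof -
    have "of_int (l ^ (d - 1) * coeff p d) * x ^ d = y ^ d"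
    proof -
      have "l ^ (d - 1) * l = l ^ d" using s by (intro power_minus_mult) (simp add: d_def)
      moreover have "coeff p d = l" by (simp add: l_def d_def)
      ultimately show ?thesis by (simp only: y_def power_mult_distrib of_int_power)
    qed
    then show ?thesis by (simp add: lessThan_Suc_atMost[symmetric])
  qed
  also have "(\<Sum>i<d. of_int (l ^ (d - 1) * coeff p i) * x ^ i) =
      (\<Sum>i<d. of_int (coeff p i * l ^ (d - 1 - i)) * y ^ i)"
  proof (rule sum.cong)
    fix i assume "i \<in> {..<d}"
    then have "l ^ (d - 1) = l ^ (d - 1 - i) * l ^ i" by (simp add: power_add[symmetric])
    then show "of_int (l ^ (d - 1) * coeff p i) * x ^ i = of_int (coeff p i * l ^ (d - 1 - i)) * y ^ i"
      by (simp add: y_def power_mult_distrib)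
  qed simp
  also have "\<dots> = - zval y d (\<lambda>i. - (coeff p i * l ^ (d - 1 - i)))"
    by (simp add: zval_def sum_negf)
  finally have "y ^ d = zval y d (\<lambda>i. - (coeff p i * l ^ (d - 1 - i)))" by simp
  then have "y ^ d \<in> range (zval y d)" by (simp only: rangeI)
  then show "(of_int (lead_coeff p) * x) ^ degree p \<in> zspan (of_int (lead_coeff p) * x) (degree p)"
    by (simp only: zspan_def rangeI y_def d_def l_def)
  show "\<forall>i<degree p. a i = 0" if "zval (of_int (lead_coeff p) * x) (degree p) a = 0" for a
  proof -
    define q where "q = (\<Sum>i<d. monom (a i * l ^ i) i)"
    have coeff: "coeff q i = (if i < d then a i * l ^ i else 0)" for i
      by (simp add: q_def coeff_sum if_distrib cong: if_cong)
    have deg: "degree q < d"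
      unfolding q_def using s
      by (intro degree_sum_less) (auto simp: d_def intro: le_less_trans[OF degree_monom_le])
    have "poly (map_poly of_int q) x = (\<Sum>i<d. of_int (coeff q i) * x ^ i)"
      unfolding poly_altdef
    proof (rule sum.mono_neutral_cong_left)
      show "{..degree (map_poly of_int q :: complex poly)} \<subseteq> {..<d}"
        using deg by (auto simp: degree_map_poly)
    qed (auto simp: coeff_map_poly degree_map_poly intro: coeff_eq_0)
    also have "\<dots> = zval y d a"
      by (simp add: zval_def coeff y_def power_mult_distrib mult.assoc)
    also have "\<dots> = 0" using that by (simp add: y_def d_def l_def)
    finally have "q = 0" using min deg by (simp add: d_def)
    then have "a i * l ^ i = 0" if "i < d" for i using coeff[of i] that by simp
    then show ?thesis using l by (simp add: d_def)
  qed
  show "s = 1 \<and> of_int (lead_coeff p) * x \<in> \<real> \<or> s = 2 \<and> of_int (lead_coeff p) * x \<notin> \<real>"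
    using dim l by (auto simp: complex_is_Real_iff l_def)
qed (fact s)

text \<open>\<open>no_basis\<close> leaves degree 1 for real x and degree 2 otherwise. Denominators
  are then excluded by \<open>Rats_infinite_units\<close> and
  \<open>nonintegral_infinite_units\<close> respectively.\<close>

lemma finite_units_dichotomy:
  assumes S: "subring S complex_ring" and x: "x \<in> S" "algebraic x"
    and fin: "finite {u \<in> S. u \<noteq> 0 \<and> inverse u \<in> S}"
  shows "x \<in> \<int> \<or> x \<notin> \<real> \<and> algebraic_int x \<and> (\<exists>a b c. imaginary_quadratic x a b c)"
proof -
  obtain p :: "int poly" where p: "p \<noteq> 0" "poly (map_poly of_int p) x = 0"
    and min: "\<And>q :: int poly. poly (map_poly of_int q) x = 0 \<Longrightarrow> degree q < degree p \<Longrightarrow> q = 0"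
    using ex_min_int_poly[OF x(2)] by blast
  have no_basis: "\<not> s < degree p" if "s = 1 \<and> x \<in> \<real> \<or> s = 2 \<and> x \<notin> \<real>" for s
  proof
    assume "s < degree p"
    then have "order_basis (of_int (lead_coeff p) * x) (degree p) s"
      using min that by (intro order_basis_leading_multiple[OF p]) blast+
    then have "infinite {u \<in> zspan (of_int (lead_coeff p) * x) (degree p). u \<noteq> 0 \<and>
        inverse u \<in> zspan (of_int (lead_coeff p) * x) (degree p)}"
      by (rule order_basis.infinite_units)
    moreover have "zspan (of_int (lead_coeff p) * x) (degree p) \<subseteq> S"
      using subring_complex_closed[OF S] subring_complex_of_int[OF S] x(1)
      by (intro zspan_subset_subring[OF S]) auto
    ultimately show False using fin infinite_units_mono by blast
  qed
  have root: "(\<Sum>i\<le>degree p. of_int (coeff p i) * x ^ i) = 0"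
    using p(2) by (simp add: poly_altdef degree_map_poly coeff_map_poly)
  have Rats: "x \<in> \<rat>" if "degree p \<le> 1"
  proof -
    have lin: "of_int (coeff p 0) + of_int (coeff p 1) * x = 0"
    proof (cases "degree p = 0")
      case True
      with root have "of_int (coeff p 0) = (0::complex)" by simp
      with True have "p = 0" by (metis leading_coeff_0_iff of_int_eq_0_iff)
      with p show ?thesis by simp
    next
      case False
      with that have "degree p = 1" by simp
      with root show ?thesis by simp
    qed
    have "coeff p 1 \<noteq> 0"
    proof
      assume "coeff p 1 = 0"
      with lin have "coeff p 0 = 0" by simp
      with \<open>coeff p 1 = 0\<close> that have "lead_coeff p = 0" by (cases "degree p = 0") (auto simp: le_Suc_eq)
      with p show False by simp
    qed
    with lin have "x = - (of_int (coeff p 0) / of_int (coeff p 1))"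
      by (simp add: field_simps add_eq_0_iff)
    then show ?thesis by auto
  qed
  show ?thesis
  proof (cases "x \<in> \<real>")
    case True
    then have "x \<in> \<rat>" using Rats no_basis[of 1] by simp
    then have "x \<in> \<int>" using Rats_infinite_units[OF S x(1)] fin by blast
    then show ?thesis ..
  next
    case False
    have "degree p = 2"
    proof -
      have "\<not> degree p \<le> 1" using Rats False by (auto elim!: Rats_cases')
      then show ?thesis using no_basis[of 2] False by simp
    qed
    then have "coeff p 2 \<noteq> 0" using p(1) by (metis leading_coeff_0_iff)
    with \<open>degree p = 2\<close> have iq: "imaginary_quadratic x (coeff p 0) (coeff p 1) (coeff p 2)"
      using root False by unfold_locales (auto simp: numeral_2_eq_2 algebra_simps)
    then interpret imaginary_quadratic x "coeff p 0" "coeff p 1" "coeff p 2" .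
    have "algebraic_int x"
    proof (rule ccontr)
      assume "\<not> algebraic_int x"
      moreover have "\<Union> (range (zspan x)) \<subseteq> S"
        using zspan_subset_subring[OF S x(1)] by blast
      ultimately show False
        using nonintegral_infinite_units infinite_units_mono fin by blast
    qed
    with iq False show ?thesis by blast
  qed
qed

section \<open>Imaginary quadratic orders\<close>

lemma Ints_trace_norm: "x \<in> \<int> \<Longrightarrow> 2 * Re x \<in> \<int> \<and> (cmod x)\<^sup>2 \<in> \<int>"
  by (auto elim!: Ints_cases simp flip: of_int_abs of_int_power)

lemma cmod_ge_1:
  assumes "(cmod x)\<^sup>2 \<in> \<int>" "x \<noteq> 0"
  shows "cmod x \<ge> 1"
proof (rule ccontr)
  assume "\<not> cmod x \<ge> 1"
  obtain k where k: "(cmod x)\<^sup>2 = of_int k" using assms(1) by (elim Ints_cases)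
  have "(cmod x)\<^sup>2 < 1" "(cmod x)\<^sup>2 > 0"
    using \<open>\<not> cmod x \<ge> 1\<close> assms(2) by (auto simp: power_less_one_iff abs_square_less_1)
  with k show False by simp
qed

text \<open>Trace and norm take finitely many values on a ball, and they determine x up to the sign
  of its imaginary part.\<close>

lemma finite_trace_norm_ball:
  "finite {x. 2 * Re x \<in> \<int> \<and> (cmod x)\<^sup>2 \<in> \<int> \<and> cmod x \<le> B}"
proof -
  define T where "T = \<lceil>2 * \<bar>B\<bar>\<rceil>"
  define N where "N = \<lceil>B\<^sup>2\<rceil>"
  define f where "f = (\<lambda>(t, n, e). Complex (of_int t / 2) (e * sqrt (of_int n - (of_int t / 2)\<^sup>2)))"
  have "{x. 2 * Re x \<in> \<int> \<and> (cmod x)\<^sup>2 \<in> \<int> \<and> cmod x \<le> B} \<subseteq> f ` ({-T..T} \<times> {0..N} \<times> {-1, 1})"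
  proof clarify
    fix x assume x: "2 * Re x \<in> \<int>" "(cmod x)\<^sup>2 \<in> \<int>" "cmod x \<le> B"
    obtain t where t: "2 * Re x = of_int t" using x(1) by (elim Ints_cases)
    obtain n where n: "(cmod x)\<^sup>2 = of_int n" using x(2) by (elim Ints_cases)
    have "\<bar>2 * Re x\<bar> \<le> 2 * \<bar>B\<bar>" using x(3) abs_Re_le_cmod[of x] by linarith
    then have "\<bar>of_int t\<bar> \<le> 2 * \<bar>B\<bar>" by (simp only: t)
    then have tT: "t \<in> {-T..T}" unfolding T_def by simp linarith
    have "(cmod x)\<^sup>2 \<le> B\<^sup>2" using x(3) by (intro power_mono) auto
    moreover have "0 \<le> (cmod x)\<^sup>2" by simp
    ultimately have nN: "n \<in> {0..N}" unfolding N_def n by simp linarith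
    have Re: "Re x = of_int t / 2" using t by simp
    have "(Im x)\<^sup>2 = of_int n - (of_int t / 2)\<^sup>2" using n by (simp add: cmod_power2 Re)
    then have "\<bar>Im x\<bar> = sqrt (of_int n - (of_int t / 2)\<^sup>2)" by (metis real_sqrt_abs)
    then have "x = f (t, n, if Im x \<ge> 0 then 1 else -1)"
      by (auto simp: f_def complex_eq_iff Re)
    then show "x \<in> f ` ({-T..T} \<times> {0..N} \<times> {-1, 1})"
      using tT nN by (intro image_eqI[of _ f "(t, n, if Im x \<ge> 0 then 1 else -1)"] SigmaI) simp_all
  qed
  then show ?thesis by (rule finite_subset) auto
qed

section \<open>The field generated by sqrt(-m) in real coordinates, and its integers\<close>

lemma csqrt_neg_int:
  assumes "m > 0"
  shows "csqrt (of_int (- m)) = \<i> * of_real (sqrt (of_int m))"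
proof -
  have "csqrt (of_int (- m)) = \<i> * of_real (sqrt \<bar>Re (of_int (- m))\<bar>)"
    using assms by (intro csqrt_of_real_nonpos) simp_all
  then show ?thesis using assms by simp
qed

lemma quadratic_field_eq:
  fixes m :: int
  assumes m: "m > 0"
  shows "quadratic_field (- m) = {x. Re x \<in> \<rat> \<and> (\<exists>q\<in>\<rat>. Im x = q * sqrt (of_int m))}"
proof
  let ?w = "\<i> * of_real (sqrt (of_int m)) :: complex"
  have sq: "sqrt (of_int m) * sqrt (of_int m) = real_of_int m" using m by simp
  show "quadratic_field (- m) \<subseteq> {x. Re x \<in> \<rat> \<and> (\<exists>q\<in>\<rat>. Im x = q * sqrt (of_int m))}"
  proof
    fix x assume "x \<in> quadratic_field (- m)"
    then have "x \<in> generate_field complex_ring {?w}"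
      by (simp only: quadratic_field_def csqrt_neg_int[OF m])
    then have "Re x \<in> \<rat> \<and> (\<exists>q\<in>\<rat>. Im x = q * sqrt (of_int m))"
    proof induction
      case one
      show ?case by (auto intro: bexI[of _ 0])
    next
      case (incl h)
      then show ?case by (auto intro: bexI[of _ 1])
    next
      case (a_inv h)
      then obtain q where "q \<in> \<rat>" "Im h = q * sqrt (of_int m)" by auto
      with a_inv show ?case by (auto intro: bexI[of _ "- q"])
    next
      case (m_inv h)
      then obtain q where q: "q \<in> \<rat>" "Im h = q * sqrt (of_int m)" by auto
      have N: "(Re h)\<^sup>2 + (Im h)\<^sup>2 = (Re h)\<^sup>2 + q\<^sup>2 * of_int m"
        using m by (simp add: q(2) power_mult_distrib)
      have "Re (inverse h) = Re h / ((Re h)\<^sup>2 + q\<^sup>2 * of_int m)"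
        "Im (inverse h) = (- q / ((Re h)\<^sup>2 + q\<^sup>2 * of_int m)) * sqrt (of_int m)"
        unfolding inverse_complex.sel N by (simp_all add: q(2))
      moreover have "Re h / ((Re h)\<^sup>2 + q\<^sup>2 * of_int m) \<in> \<rat>" "- q / ((Re h)\<^sup>2 + q\<^sup>2 * of_int m) \<in> \<rat>"
        using m_inv q(1) by auto
      moreover have "inv\<^bsub>complex_ring\<^esub> h = inverse h"
        using m_inv by (simp add: complex_ring_inv)
      ultimately show ?case by metis
    next
      case (eng_add h1 h2)
      then obtain q1 q2 where "q1 \<in> \<rat>" "Im h1 = q1 * sqrt (of_int m)" "q2 \<in> \<rat>" "Im h2 = q2 * sqrt (of_int m)"
        by auto
      with eng_add show ?case by (auto intro!: bexI[of _ "q1 + q2"] simp: algebra_simps)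
    next
      case (eng_mult h1 h2)
      then obtain q1 q2 where q: "q1 \<in> \<rat>" "Im h1 = q1 * sqrt (of_int m)" "q2 \<in> \<rat>" "Im h2 = q2 * sqrt (of_int m)"
        by auto
      have "Re (h1 * h2) = Re h1 * Re h2 - q1 * q2 * of_int m"
      proof -
        have "Re (h1 * h2) = Re h1 * Re h2 - q1 * q2 * (sqrt (of_int m) * sqrt (of_int m))"
          by (simp add: q)
        then show ?thesis by (simp only: sq)
      qed
      moreover have "Im (h1 * h2) = (Re h1 * q2 + q1 * Re h2) * sqrt (of_int m)"
        by (simp add: q algebra_simps)
      moreover have "Re h1 * Re h2 - q1 * q2 * of_int m \<in> \<rat>" "Re h1 * q2 + q1 * Re h2 \<in> \<rat>"
        using eng_mult q by auto
      ultimately show ?case by (metis complex_ring_simps(2))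
    qed
    then show "x \<in> {x. Re x \<in> \<rat> \<and> (\<exists>q\<in>\<rat>. Im x = q * sqrt (of_int m))}" by simp
  qed
  let ?F = "generate_field complex_ring {?w}"
  have closed: "1 \<in> ?F" "?w \<in> ?F" "\<And>x. x \<in> ?F \<Longrightarrow> - x \<in> ?F" "\<And>x y. x \<in> ?F \<Longrightarrow> y \<in> ?F \<Longrightarrow> x + y \<in> ?F"
    "\<And>x y. x \<in> ?F \<Longrightarrow> y \<in> ?F \<Longrightarrow> x * y \<in> ?F" "\<And>x. x \<in> ?F \<Longrightarrow> x \<noteq> 0 \<Longrightarrow> inverse x \<in> ?F"
    using generate_field.intros[where R = complex_ring and H = "{?w}"] complex_ring_inv
    by simp_all
  have of_int: "of_int k \<in> ?F" for k
  proof (induction k rule: int_induct[where k = 0])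
    case base
    show ?case using closed(4)[OF closed(1) closed(3)[OF closed(1)]] by simp
  next
    case (step1 i)
    then show ?case using closed(1,4) by simp
  next
    case (step2 i)
    then show ?case using closed(4)[OF _ closed(3)[OF closed(1)], of "of_int i"] by simp
  qed
  have Rats: "of_real q \<in> ?F" if "q \<in> \<rat>" for q
  proof -
    obtain a b where "b > 0" "q = of_int a / of_int b" using \<open>q \<in> \<rat>\<close> by (metis Rats_cases')
    then have "of_real q = of_int a * inverse (of_int b :: complex)" "of_int b \<noteq> (0::complex)"
      by (simp_all add: divide_inverse)
    then show ?thesis using closed(5,6) of_int by metis
  qed
  show "{x. Re x \<in> \<rat> \<and> (\<exists>q\<in>\<rat>. Im x = q * sqrt (of_int m))} \<subseteq> quadratic_field (- m)"
  proof clarify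
    fix x q assume x: "Re x \<in> \<rat>" "q \<in> \<rat>" "Im x = q * sqrt (of_int m)"
    have "x = of_real (Re x) + of_real q * ?w" by (simp add: complex_eq_iff x(3))
    also have "\<dots> \<in> ?F"
      by (rule closed(4)[OF Rats[OF x(1)] closed(5)[OF Rats[OF x(2)] closed(2)]])
    finally show "x \<in> quadratic_field (- m)"
      by (simp only: quadratic_field_def csqrt_neg_int[OF m])
  qed
qed

text \<open>For non-real x the equation with coefficients trace and norm, cleared of denominators,
  makes x an instance of \<open>imaginary_quadratic\<close>; a real x is a rational algebraic
  integer.\<close>

lemma integral_trace_norm_of_rational:
  assumes "algebraic_int x" "2 * Re x \<in> \<rat>" "(cmod x)\<^sup>2 \<in> \<rat>"
  shows "2 * Re x \<in> \<int> \<and> (cmod x)\<^sup>2 \<in> \<int>"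
proof (cases "x \<in> \<real>")
  case True
  then have "x = of_real (Re x)" by (simp add: complex_is_Real_iff complex_eq_iff)
  moreover have "Re x \<in> \<rat>" using Rats_divide[OF assms(2), of 2] by simp
  ultimately have "x \<in> \<rat>" by (metis Rats_complex_of_real_iff)
  then have "x \<in> \<int>" using assms(1) by (rule rational_algebraic_int_is_int[rotated])
  then show ?thesis by (rule Ints_trace_norm)
next
  case False
  obtain a1 c1 where 1: "c1 > 0" "2 * Re x = of_int a1 / of_int c1" using assms(2) by (metis Rats_cases')
  obtain a2 c2 where 2: "c2 > 0" "(cmod x)\<^sup>2 = of_int a2 / of_int c2" using assms(3) by (metis Rats_cases')
  have sq: "x\<^sup>2 - of_real (2 * Re x) * x + of_real ((cmod x)\<^sup>2) = 0"
    unfolding cmod_power2 by (simp add: complex_eq_iff power2_eq_square algebra_simps)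
  interpret imaginary_quadratic x "a2 * c1" "- (a1 * c2)" "c1 * c2"
  proof
    have "of_int (c1 * c2) * x\<^sup>2 + of_int (- (a1 * c2)) * x + of_int (a2 * c1) =
        of_int (c1 * c2) * (x\<^sup>2 - of_real (2 * Re x) * x + of_real ((cmod x)\<^sup>2))"
      unfolding 1(2) 2(2) using 1(1) 2(1) by (simp add: field_simps)
    then show "of_int (c1 * c2) * x\<^sup>2 + of_int (- (a1 * c2)) * x + of_int (a2 * c1) = 0"
      by (simp only: sq mult_zero_right)
  qed (use 1 2 False in auto)
  show ?thesis using integral_trace_norm[OF assms(1)] by simp
qed

lemma ring_of_integers_trace_norm:
  assumes m: "m > 0" and x: "x \<in> ring_of_integers (quadratic_field (- m))"
  shows "2 * Re x \<in> \<int> \<and> (cmod x)\<^sup>2 \<in> \<int>"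
proof -
  obtain q where q: "Re x \<in> \<rat>" "q \<in> \<rat>" "Im x = q * sqrt (of_int m)" "algebraic_int x"
    using x by (auto simp: ring_of_integers_def quadratic_field_eq[OF m])
  have "(cmod x)\<^sup>2 = (Re x)\<^sup>2 + q\<^sup>2 * of_int m"
    unfolding cmod_power2 q(3) using m by (simp add: power_mult_distrib)
  then show ?thesis using q by (intro integral_trace_norm_of_rational) auto
qed

section \<open>Frieze subrings\<close>

lemma frieze_subring_is_subring: "subring (frieze_subring R) complex_ring"
  unfolding frieze_subring_def by (rule complex_ring.generate_ring_is_subring) simp

lemma frieze_subring_subset:
  assumes "subring R complex_ring"
  shows "frieze_subring R \<subseteq> R"
  unfolding frieze_subring_def
proof (rule complex_ring.generate_ring_min_subring1[OF _ assms])
  show "(\<Union>n. \<Union>c\<in>nonzero_friezes n R. c ` frieze_indices n) \<subseteq> R"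
  proof clarify
    fix n c i j assume c: "c \<in> nonzero_friezes n R" and ij: "(i, j) \<in> frieze_indices n"
    then have "c (i, j) = 0 \<or> c (i, j) \<in> insert 1 R"
      using frieze_interior(2)[OF c, of i j] frieze_zero[OF c, of i]
      by (cases "i = j \<or> j = int n + i + 3") (auto simp: frieze_indices_def)
    then show "c (i, j) \<in> R" using subring_complex_closed(1,2)[OF assms] by auto
  qed
qed simp

text \<open>Passing to the frieze subring loses no frieze: finiteness over it transfers to
  \<open>R\<close>, and its arithmetic may be used on the entries.\<close>

lemma nonzero_friezes_frieze_subring: "nonzero_friezes n R \<subseteq> nonzero_friezes n (frieze_subring R)"
proof
  fix c assume c: "c \<in> nonzero_friezes n R"
  have "c (i, j) \<in> frieze_subring R" if "i + 2 \<le> j" "j \<le> int n + i + 1" for i j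
    unfolding frieze_subring_def
  proof (rule generate_ring.incl)
    have "(i, j) \<in> frieze_indices n" using that by (simp add: frieze_indices_def)
    then show "c (i, j) \<in> (\<Union>n. \<Union>c\<in>nonzero_friezes n R. c ` frieze_indices n)" using c by blast
  qed
  with c show "c \<in> nonzero_friezes n (frieze_subring R)"
    by (simp add: nonzero_friezes_def)
qed

lemma frieze_subring_eq_Ints:
  assumes short: "\<And>w. w \<in> frieze_subring R \<Longrightarrow> cmod w < 2 \<Longrightarrow> w \<in> \<int>"
    and ge1: "\<And>w. w \<in> frieze_subring R \<Longrightarrow> w \<noteq> 0 \<Longrightarrow> cmod w \<ge> 1"
  shows "frieze_subring R = \<int>"
proof
  note S = frieze_subring_is_subring[of R]
  show "\<int> \<subseteq> frieze_subring R" using subring_complex_of_int[OF S] by (auto elim: Ints_cases)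
  have Ints: "subring \<int> complex_ring"
    by (rule complex_ring.subringI) auto
  show "frieze_subring R \<subseteq> \<int>"
    unfolding frieze_subring_def
  proof (rule complex_ring.generate_ring_min_subring1[OF _ Ints])
    show "(\<Union>n. \<Union>c\<in>nonzero_friezes n R. c ` frieze_indices n) \<subseteq> \<int>"
    proof clarify
      fix n c i j assume c: "c \<in> nonzero_friezes n R" and ij: "(i, j) \<in> frieze_indices n"
      have c': "c \<in> nonzero_friezes n (frieze_subring R)"
        using c nonzero_friezes_frieze_subring by blast
      have ij': "i \<le> j" "j \<le> int n + i + 3" using ij by (auto simp: frieze_indices_def)
      show "c (i, j) \<in> \<int>"
        using frieze_entry_cases[OF c' ij']
      proof cases
        case 1
        then show ?thesis by simp
      next
        case (2 u v)
        note vecs = frieze_vecs[OF c', of "i - 1"]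
        have "\<forall>u\<in>set (frieze_vecs n c (i - 1)). \<forall>v\<in>set (frieze_vecs n c (i - 1)). det2 u v \<in> \<int>"
        proof (rule polygon_Ints[OF short])
          show "sorted_wrt (\<lambda>x y. det2 x y \<in> frieze_subring R \<and> cmod (det2 x y) \<ge> 1) (frieze_vecs n c (i - 1))"
            using vecs(2)
            by (rule sorted_wrt_mono_rel[rotated])
               (use ge1 subring_complex_closed(2)[OF S] in auto)
          show "successively (\<lambda>x y. det2 x y \<in> {-1, 1}) (frieze_vecs n c (i - 1))"
            using vecs(3) by (rule successively_mono) auto
        qed (use vecs(4) in auto)
        with 2 show ?thesis by simp
      qed
    qed
  qed simp
qed

text \<open>If q x = m + n w, the coset of x depends only on m and n modulo q, since (m div q) + (n
  div q) w lies in \<open>S\<close>. So there are at most q^2 cosets.\<close>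

lemma finite_a_rcosets:
  fixes w :: complex and q :: int
  assumes S: "subring S complex_ring" and w: "w \<in> S" and q: "q > 0"
    and rep: "\<And>x. x \<in> K \<Longrightarrow> \<exists>m n. of_int q * x = of_int m + of_int n * w"
  shows "finite (a_rcosets\<^bsub>complex_ring\<lparr>carrier := K\<rparr>\<^esub> S)"
proof -
  \<comment> \<open>The representative (m + n w) / q may lie outside \<open>K\<close>; the translate
    is formed in the complex numbers.\<close>
  define F where "F = (\<lambda>(m, n). {h + (of_int m + of_int n * w) / of_int q |h. h \<in> S})"
  have "a_rcosets\<^bsub>complex_ring\<lparr>carrier := K\<rparr>\<^esub> S \<subseteq> F ` ({0..<q} \<times> {0..<q})"
  proof
    fix C assume "C \<in> a_rcosets\<^bsub>complex_ring\<lparr>carrier := K\<rparr>\<^esub> S"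
    then obtain x where x: "x \<in> K" "C = {h + x |h. h \<in> S}"
      by (auto simp: A_RCOSETS_def' a_r_coset_def r_coset_def ring_of_type_algebra_def)
    obtain m n where mn: "of_int q * x = of_int m + of_int n * w" using rep[OF x(1)] by blast
    define d where "d = of_int (m div q) + of_int (n div q) * w"
    define x0 where "x0 = (of_int (m mod q) + of_int (n mod q) * w) / of_int q"
    have d: "d \<in> S"
      unfolding d_def using subring_complex_closed[OF S] subring_complex_of_int[OF S] w by simp
    have "(of_int k :: complex) = of_int q * of_int (k div q) + of_int (k mod q)" for k
      by (metis mult_div_mod_eq of_int_add of_int_mult)
    then have "of_int q * x = of_int q * of_int (m div q) + of_int (m mod q) +
        (of_int q * of_int (n div q) + of_int (n mod q)) * w"
      using mn by metis
    also have "\<dots> = of_int q * (d + x0)"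
      using q by (simp add: d_def x0_def algebra_simps)
    finally have xd: "x = d + x0" using q by simp
    have "C = {h + x0 |h. h \<in> S}"
    proof (intro equalityI subsetI)
      fix v assume "v \<in> C"
      then obtain h where "h \<in> S" "v = (h + d) + x0" by (auto simp: x xd add.assoc)
      then show "v \<in> {h + x0 |h. h \<in> S}" using subring_complex_closed(4)[OF S _ d] by blast
    next
      fix v assume "v \<in> {h + x0 |h. h \<in> S}"
      then obtain h where "h \<in> S" "v = (h - d) + x" by (auto simp: xd)
      then show "v \<in> C" using subring_complex_closed(5)[OF S _ d] by (auto simp: x)
    qed
    then have "C = F (m mod q, n mod q)" by (simp add: F_def x0_def)
    moreover have "(m mod q, n mod q) \<in> {0..<q} \<times> {0..<q}" using q by simp
    ultimately show "C \<in> F ` ({0..<q} \<times> {0..<q})" by blast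
  qed
  then show ?thesis by (rule finite_subset) auto
qed

lemma Rats_square_Ints:
  fixes u :: real
  assumes "u \<in> \<rat>" "u\<^sup>2 \<in> \<int>"
  shows "u \<in> \<int>"
proof -
  have "algebraic_int u"
  proof (rule algebraic_int.intros)
    show "lead_coeff (monom 1 2 - [:u\<^sup>2:]) = 1"
      by (simp add: monom_altdef numeral_2_eq_2)
    show "\<forall>i. coeff (monom 1 2 - [:u\<^sup>2:]) i \<in> \<int>"
      using assms(2) by (auto simp: coeff_pCons split: nat.split)
    show "poly (monom 1 2 - [:u\<^sup>2:]) u = 0" by (simp add: poly_monom)
  qed
  then show ?thesis using assms(1) by (rule rational_algebraic_int_is_int)
qed

text \<open>\<open>D\<close> is minus the discriminant of w. Inclusion in the field: x minus its
  conjugate is 2 x minus the trace, so it lies in \<open>S\<close>; the product of two such purely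
  imaginary elements is real, hence an integer, and comparison with w makes Im x a rational multiple
  of sqrt m. Finite index: for an integer x of the field, (2 Im w)(2 Im x) is an integer, which
  expresses 2 D x through 1 and w.\<close>

lemma order_of_short_element:
  assumes S: "subring S complex_ring"
    and alg: "\<And>x. x \<in> S \<Longrightarrow> algebraic_int x"
    and real: "\<And>x. x \<in> S \<Longrightarrow> x \<in> \<real> \<Longrightarrow> x \<in> \<int>"
    and trace: "\<And>x. x \<in> S \<Longrightarrow> 2 * Re x \<in> \<int>"
    and w: "w \<in> S" "w \<notin> \<int>" and m: "m > 0" and r: "r \<in> \<rat>" "2 * Im w = r * sqrt (of_int m)"
    and D: "D > 0" "(2 * Im w)\<^sup>2 = of_int D"
  shows "is_order_in S (quadratic_field (- m))"
proof -
  note closed = subring_complex_closed[OF S] and Z = subring_complex_of_int[OF S]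
  have Im_w: "Im w \<noteq> 0" using D by auto
  have r0: "r \<noteq> 0" using r(2) Im_w by auto
  have sqrt: "sqrt (real_of_int m) * sqrt (real_of_int m) = of_int m" using m by simp
  have pure: "\<i> * of_real (2 * Im x) \<in> S" if x: "x \<in> S" for x
  proof -
    obtain t where t: "2 * Re x = of_int t" using trace[OF x] by (elim Ints_cases)
    have "\<i> * of_real (2 * Im x) = 2 * x - of_int t"
      using t by (simp add: complex_eq_iff)
    also have "\<dots> \<in> S" using closed(5,6) Z[of 2] Z[of t] x by simp
    finally show ?thesis .
  qed
  have sub: "S \<subseteq> ring_of_integers (quadratic_field (- m))"
  proof
    fix x assume x: "x \<in> S"
    have "(\<i> * of_real (2 * Im x)) * (\<i> * of_real (2 * Im w)) \<in> S"
      using pure[OF x] pure[OF w(1)] closed(6) by blast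
    moreover have "(\<i> * of_real (2 * Im x)) * (\<i> * of_real (2 * Im w)) = of_real (- (2 * Im x * (2 * Im w)))"
      by (simp add: complex_eq_iff)
    ultimately have "of_real (- (2 * Im x * (2 * Im w))) \<in> (\<int> :: complex set)"
      using real by (metis Reals_of_real)
    then obtain k where "of_real (- (2 * Im x * (2 * Im w))) = (of_int k :: complex)" by (elim Ints_cases)
    then have k: "2 * Im x * (2 * Im w) = - of_int k"
      by (metis add.inverse_inverse of_real_eq_iff of_real_of_int_eq)
    have "Im x = (- of_int k / (2 * r * of_int m)) * sqrt (of_int m)"
    proof -
      have "2 * Im x * r * of_int m = (2 * Im x * (2 * Im w)) * sqrt (of_int m)"
      proof -
        have "2 * Im x * r * of_int m = 2 * Im x * r * (sqrt (of_int m) * sqrt (of_int m))"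
          by (simp only: sqrt)
        also have "\<dots> = 2 * Im x * (r * sqrt (of_int m)) * sqrt (of_int m)"
          by (simp only: mult_ac)
        finally show ?thesis by (simp only: r(2))
      qed
      then show ?thesis unfolding k using r0 m by (simp add: field_simps)
    qed
    moreover have "- of_int k / (2 * r * of_int m) \<in> \<rat>" using r(1) by simp
    moreover obtain t where "2 * Re x = of_int t" using trace[OF x] by (elim Ints_cases)
    then have Re_x: "Re x = of_int t / 2" by simp
    have "Re x \<in> \<rat>" unfolding Re_x by simp
    ultimately have "x \<in> quadratic_field (- m)"
      unfolding quadratic_field_eq[OF m] by blast
    then show "x \<in> ring_of_integers (quadratic_field (- m))"
      using alg[OF x] by (simp add: ring_of_integers_def)
  qed
  have rep: "\<exists>k l. of_int (2 * D) * x = of_int k + of_int l * w"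
    if x: "x \<in> ring_of_integers (quadratic_field (- m))" for x
  proof -
    obtain q where q: "q \<in> \<rat>" "Im x = q * sqrt (of_int m)"
      using x m by (auto simp: ring_of_integers_def quadratic_field_eq)
    obtain t n where t: "2 * Re x = of_int t" and n: "(cmod x)\<^sup>2 = of_int n"
      using ring_of_integers_trace_norm[OF m x] by (auto elim!: Ints_cases)
    \<comment> \<open>Rational, because both factors are rational multiples of sqrt m, and with
      integral square, because the squares of the factors are minus the discriminants of w and
      x.\<close>
    define \<beta> where "\<beta> = (2 * Im w) * (2 * Im x)"
    have "\<beta> = r * (2 * q) * (sqrt (of_int m) * sqrt (of_int m))"
      by (simp add: \<beta>_def r(2) q(2))
    then have "\<beta> \<in> \<rat>" unfolding sqrt using r(1) q(1) by simp
    moreover have "\<beta>\<^sup>2 \<in> \<int>"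
    proof -
      have "(2 * Im x)\<^sup>2 = 4 * (cmod x)\<^sup>2 - (2 * Re x)\<^sup>2" by (simp add: cmod_power2 power_mult_distrib)
      also have "\<dots> = of_int (4 * n - t\<^sup>2)" by (simp add: n t)
      finally have "\<beta>\<^sup>2 = of_int D * of_int (4 * n - t\<^sup>2)"
        unfolding \<beta>_def power_mult_distrib[of "2 * Im w"] D(2) by simp
      then show ?thesis by simp
    qed
    ultimately have "\<beta> \<in> \<int>" by (rule Rats_square_Ints)
    then obtain l where l: "\<beta> = of_int l" by (elim Ints_cases)
    obtain tw where tw: "2 * Re w = of_int tw" using trace[OF w(1)] by (elim Ints_cases)
    have "of_int (2 * D) * x = of_int (D * t - l * tw) + of_int (2 * l) * w"
    proof (rule complex_eqI)
      show "Re (of_int (2 * D) * x) = Re (of_int (D * t - l * tw) + of_int (2 * l) * w)"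
        by (simp add: t[symmetric] tw[symmetric])
      have "of_int D * Im x = of_int l * Im w"
        unfolding l[symmetric] D(2)[symmetric] \<beta>_def by (simp add: power2_eq_square)
      then show "Im (of_int (2 * D) * x) = Im (of_int (D * t - l * tw) + of_int (2 * l) * w)"
        by simp
    qed
    then show ?thesis by blast
  qed
  have "finite (a_rcosets\<^bsub>complex_ring\<lparr>carrier := ring_of_integers (quadratic_field (- m))\<rparr>\<^esub> S)"
    using D(1) rep by (intro finite_a_rcosets[OF S w(1), of "2 * D"]) auto
  with S sub show ?thesis by (simp add: is_order_in_def)
qed

text \<open>\<open>D\<close> is 4 n - t^2 with trace t and norm n <= 3. Its positive values are 3,
  4, 7, 8, 11 and 12, where 12 = 2^2 * 3 leads to the same field as 3.\<close>

lemma short_element_discriminant: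
  assumes w: "w \<notin> \<real>" "cmod w < 2" and "2 * Re w \<in> \<int>" "(cmod w)\<^sup>2 \<in> \<int>"
  obtains D m e where "(m, e) \<in> {(1, 2), (2, 2), (3, 1), (3, 2), (7, 1), (11, 1)}"
    "(2 * Im w)\<^sup>2 = real_of_int D" "D = e\<^sup>2 * m"
proof -
  obtain t n where t: "2 * Re w = of_int t" and n: "(cmod w)\<^sup>2 = of_int n"
    using assms(3,4) by (auto elim!: Ints_cases)
  have "(2 * Im w)\<^sup>2 = 4 * (cmod w)\<^sup>2 - (2 * Re w)\<^sup>2" by (simp add: cmod_power2 power_mult_distrib)
  also have "\<dots> = of_int (4 * n - t\<^sup>2)" by (simp add: n t)
  finally have D: "(2 * Im w)\<^sup>2 = of_int (4 * n - t\<^sup>2)" .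
  have "Im w \<noteq> 0" using w(1) complex_is_Real_iff by blast
  then have "0 < (2 * Im w)\<^sup>2" by simp
  then have "0 < 4 * n - t\<^sup>2" by (simp only: D of_int_0_less_iff)
  then have pos: "t\<^sup>2 < 4 * n" by simp
  have "(cmod w)\<^sup>2 < 2\<^sup>2" using w(2) by (intro power_strict_mono) auto
  then have n3: "n \<le> 3" unfolding n by simp
  have "t\<^sup>2 < 4\<^sup>2" using pos n3 by simp
  then have "\<bar>t\<bar> < 4" by (metis abs_of_nonneg power2_less_imp_less abs_ge_zero power2_abs zero_le_numeral)
  then have "t \<in> {-3, -2, -1, 0, 1, 2, 3}" by auto
  then have t2: "t\<^sup>2 \<in> {0, 1, 4, 9}" by auto
  have "0 < n" using pos by (metis le_less_trans mult_pos_pos zero_le_power2 zero_less_mult_pos zero_less_numeral)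
  then have "n \<in> {1, 2, 3}" using n3 by auto
  then have "4 * n - t\<^sup>2 \<in> {3, 4, 7, 8, 11, 12}"
    using t2 pos by auto
  then consider "4 * n - t\<^sup>2 = 3" | "4 * n - t\<^sup>2 = 4" | "4 * n - t\<^sup>2 = 7"
    | "4 * n - t\<^sup>2 = 8" | "4 * n - t\<^sup>2 = 11" | "4 * n - t\<^sup>2 = 12"
    by auto
  then show thesis
  proof cases
    case 1
    show thesis by (rule that[of 3 1, OF _ D]) (simp_all add: 1)
  next
    case 2
    show thesis by (rule that[of 1 2, OF _ D]) (simp_all add: 2)
  next
    case 3
    show thesis by (rule that[of 7 1, OF _ D]) (simp_all add: 3)
  next
    case 4
    show thesis by (rule that[of 2 2, OF _ D]) (simp_all add: 4)
  next
    case 5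
    show thesis by (rule that[of 11 1, OF _ D]) (simp_all add: 5)
  next
    case 6
    show thesis by (rule that[of 3 2, OF _ D]) (simp_all add: 6)
  qed
qed

theorem theorem3p5:
  fixes R :: "complex set"
  assumes "subring R complex_ring"
    and "frieze_subring R \<subseteq> {x. algebraic x}"
  shows "(\<forall>n::nat. n > 0 \<longrightarrow> finite (nonzero_friezes n R)) \<longleftrightarrow>
     frieze_subring R = \<int> \<or>
     (\<exists>d\<in>{-1, -2, -3, -7, -11}. is_order_in (frieze_subring R) (quadratic_field d))"
    (is "?fin \<longleftrightarrow> ?Z \<or> ?order")
proof
  define S where "S = frieze_subring R"
  have S: "subring S complex_ring" unfolding S_def by (rule frieze_subring_is_subring)
  {
    assume fin: ?fin
    have "finite {u \<in> R. u \<noteq> 0 \<and> inverse u \<in> R}"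
    proof (rule ccontr)
      assume "infinite {u \<in> R. u \<noteq> 0 \<and> inverse u \<in> R}"
      then have "infinite (nonzero_friezes 1 R)"
        using subring_complex_closed(6)[OF assms(1) subring_complex_of_int[OF assms(1), of 2]]
        by (intro infinite_friezes_of_units) auto
      with fin show False by auto
    qed
    then have units: "finite {u \<in> S. u \<noteq> 0 \<and> inverse u \<in> S}"
      using infinite_units_mono frieze_subring_subset[OF assms(1)] unfolding S_def by blast
    have dich: "x \<in> \<int> \<or> x \<notin> \<real> \<and> algebraic_int x \<and> (\<exists>a b c. imaginary_quadratic x a b c)"
      if "x \<in> S" for x
      using that assms(2) units by (intro finite_units_dichotomy[OF S]) (auto simp: S_def)
    have trace_norm: "2 * Re x \<in> \<int> \<and> (cmod x)\<^sup>2 \<in> \<int>" if "x \<in> S" for x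
      using dich[OF that]
    proof
      assume "x \<notin> \<real> \<and> algebraic_int x \<and> (\<exists>a b c. imaginary_quadratic x a b c)"
      then show ?thesis using imaginary_quadratic.integral_trace_norm by blast
    qed (rule Ints_trace_norm)
    have alg: "algebraic_int x" if "x \<in> S" for x
      using dich[OF that] by (auto intro: int_imp_algebraic_int)
    have real: "x \<in> \<int>" if "x \<in> S" "x \<in> \<real>" for x
      using dich that by blast
    show "?Z \<or> ?order"
    proof (cases "\<forall>w\<in>S. cmod w < 2 \<longrightarrow> w \<in> \<int>")
      case True
      then have ?Z
        using cmod_ge_1 trace_norm by (intro frieze_subring_eq_Ints) (auto simp: S_def)
      then show ?thesis ..
    next
      case False
      then obtain w where w: "w \<in> S" "cmod w < 2" "w \<notin> \<int>" by blast
      then have "w \<notin> \<real>" using real by blast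
      then obtain D m e where me: "(m, e) \<in> {(1, 2), (2, 2), (3, 1), (3, 2), (7, 1), (11, 1)}"
        and D: "(2 * Im w)\<^sup>2 = real_of_int D" "D = e\<^sup>2 * m"
        using short_element_discriminant[of w] w(2) trace_norm[OF w(1)] by metis
      have pos: "m > 0" "e > 0" "D > 0" using me D(2) by auto
      have "\<bar>2 * Im w\<bar> = sqrt (of_int D)" using D(1) by (metis real_sqrt_abs)
      also have "\<dots> = of_int e * sqrt (of_int m)"
        using pos by (simp add: D(2) real_sqrt_mult)
      finally have "2 * Im w = (if Im w \<ge> 0 then of_int e else - of_int e) * sqrt (of_int m)"
        by (auto split: if_splits)
      moreover have "(if Im w \<ge> 0 then of_int e else - of_int e) \<in> (\<rat> :: real set)" by simp
      ultimately have "is_order_in S (quadratic_field (- m))"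
        using order_of_short_element[OF S alg real _ w(1,3) pos(1) _ _ pos(3) D(1)] trace_norm by blast
      moreover have "- m \<in> {-1, -2, -3, -7, -11}" using me by auto
      ultimately show ?thesis unfolding S_def by blast
    qed
  next
    assume "?Z \<or> ?order"
    \<comment> \<open>Both cases enter through integral traces and norms alone: these force non-zero
      elements to have absolute value at least 1 and balls to be finite.\<close>
    then have tn: "2 * Re x \<in> \<int> \<and> (cmod x)\<^sup>2 \<in> \<int>" if "x \<in> S" for x
    proof
      assume ?Z
      with that show ?thesis by (intro Ints_trace_norm) (simp add: S_def)
    next
      assume ?order
      then obtain d where d: "d \<in> {-1, -2, -3, -7, -11}" "is_order_in S (quadratic_field d)"
        by (auto simp: S_def)
      \<comment> \<open>The double negation matches the form \<open>- m\<close> with m > 0.\<close>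
      then have "x \<in> ring_of_integers (quadratic_field (- (- d)))" "- d > 0"
        using that by (auto simp: is_order_in_def)
      then show ?thesis using ring_of_integers_trace_norm by blast
    qed
    show ?fin
    proof (intro allI impI)
      fix n :: nat
      have "finite (nonzero_friezes n S)"
      proof (rule finite_nonzero_friezes)
        show "cmod x \<ge> 1" if "x \<in> S" "x \<noteq> 0" for x
          using tn that by (intro cmod_ge_1) auto
        show "finite {x \<in> S. cmod x \<le> B}" for B
          using finite_trace_norm_ball[of B] by (rule finite_subset[rotated]) (use tn in auto)
      qed
      then show "finite (nonzero_friezes n R)"
        using nonzero_friezes_frieze_subring[of n R] unfolding S_def by (rule finite_subset[rotated])
    qed
  }
qed

end
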